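(* Let $X\subset\mathbb Z^n$ be a finite digital image with $c_1$-adjacency, where $n\le4$, and let $f:X\to X$ be continuous with $\bar L(f)\neq0$. Then there is an elementary cube $\sigma\subseteq X$ with $f(\sigma)=\sigma$.
   Context: On $\mathbb Z^n$, the $c_1$-adjacency declares two points adjacent iff they differ by $\pm1$ in exactly one coordinate and agree in all others. Write $x\leftrightarrow y$ for adjacent and $x\Leftrightarrow y$ for adjacent or equal; a map is continuous if $x\leftrightarrow y$ implies $f(x)\Leftrightarrow f(y)$. Cubical homology: an elementary interval is $\{a,a+1\}$ (nondegenerate) or $\{a\}$ (degenerate), $a\in\mathbb Z$; an elementary cube is $\sigma=t_1\times\dots\times t_n$ with each $t_i$ an elementary interval, and its dimension $q$ is the number of nondegenerate factors. $\bar C_q(X)$ is the free abelian group on the elementary $q$-cubes contained in $X$. With $A_i\sigma$ (resp. $B_i\sigma$) obtained by replacing $t_i$ by $\{\min t_i\}$ (resp. $\{\max t_i\}$), and $j_1<\dots<j_q$ the indices of nondegenerate factors, $\partial\sigma=\sum_{i=1}^q(-1)^i(A_{j_i}\sigma-B_{j_i}\sigma)$; $\bar H_q(X)$ is the homology. For continuous $f:X\to X$, define $\bar f_q(\sigma)=0$ if $f(\sigma)$ is not an elementary $q$-cube; otherwise $\tau=f(\sigma)$ is a $q$-cube, and identifying $\sigma$ and $\tau$ with $\{0,1\}^q$ via their nondegenerate coordinates (in increasing order, shifted by their minima), $f|_\sigma$ has the form $(x_1,\dots,x_q)\mapsto(y_1,\dots,y_q)$ with each $y_i\in\{x_{\pi(i)},1-x_{\pi(i)}\}$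 for a permutation $\pi$; set $\bar f_q(\sigma)=\operatorname{sgn}(\pi)(-1)^r\tau$, where $r$ is the number of $i$ with $y_i=1-x_{\pi(i)}$. It is known that for $n\le4$ these $\bar f_q$ form a chain map, inducing $\bar f_{*,q}$ on $\bar H_q(X)$. The cubical Lefschetz number is $\bar L(f)=\sum_{q\ge0}(-1)^q\operatorname{tr}(\bar f_{*,q})$, traces taken on $\bar H_q(X)\otimes\mathbb Q$. *)

theory Defs
  imports Complex_Main "HOL-Combinatorics.Permutations"
begin

text \<open>Points of Z^n are integer lists of length n. An elementary cube is encoded as a pair
  (a, d): a is its minimal corner and d flags the nondegenerate factors, i.e. the i-th factor
  is {a!i, a!i+1} if d!i and {a!i} otherwise.\<close>

type_synonym point = "int list"
type_synonym cube = "int list \<times> bool list"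

definition c1_adj :: "point \<Rightarrow> point \<Rightarrow> bool" where
  "c1_adj x y \<longleftrightarrow> length x = length y \<and>
     (\<exists>i<length x. \<bar>x!i - y!i\<bar> = 1 \<and> (\<forall>j<length x. j \<noteq> i \<longrightarrow> x!j = y!j))"

definition c1_adj_eq :: "point \<Rightarrow> point \<Rightarrow> bool" where
  "c1_adj_eq x y \<longleftrightarrow> c1_adj x y \<or> x = y"

definition digitally_continuous :: "point set \<Rightarrow> (point \<Rightarrow> point) \<Rightarrow> bool" where
  "digitally_continuous X f \<longleftrightarrow> f ` X \<subseteq> X \<and>
     (\<forall>x\<in>X. \<forall>y\<in>X. c1_adj x y \<longrightarrow> c1_adj_eq (f x) (f y))"

definition cube_ok :: "nat \<Rightarrow> cube \<Rightarrow> bool" where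
  "cube_ok n \<sigma> \<longleftrightarrow> length (fst \<sigma>) = n \<and> length (snd \<sigma>) = n"

definition cube_pts :: "cube \<Rightarrow> point set" where
  "cube_pts \<sigma> = {x. length x = length (fst \<sigma>) \<and>
      (\<forall>i<length (fst \<sigma>). x!i = fst \<sigma> ! i \<or> (snd \<sigma> ! i \<and> x!i = fst \<sigma> ! i + 1))}"

definition cube_dim :: "cube \<Rightarrow> nat" where
  "cube_dim \<sigma> = card {i. i < length (snd \<sigma>) \<and> snd \<sigma> ! i}"

text \<open>Elementary q-cubes contained in X.\<close>
definition cubes :: "point set \<Rightarrow> nat \<Rightarrow> nat \<Rightarrow> cube set" where
  "cubes X n q = {\<sigma>. cube_ok n \<sigma> \<and> cube_dim \<sigma> = q \<and> cube_pts \<sigma> \<subseteq> X}"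

text \<open>rank d j = number of nondegenerate indices below j.\<close>
definition rank :: "bool list \<Rightarrow> nat \<Rightarrow> nat" where
  "rank d j = card {i. i < j \<and> d!i}"

definition face_A :: "nat \<Rightarrow> cube \<Rightarrow> cube" where
  "face_A j \<sigma> = (fst \<sigma>, (snd \<sigma>)[j := False])"

definition face_B :: "nat \<Rightarrow> cube \<Rightarrow> cube" where
  "face_B j \<sigma> = ((fst \<sigma>)[j := fst \<sigma> ! j + 1], (snd \<sigma>)[j := False])"

text \<open>Coefficient of tau in the boundary of sigma:
  \<partial>\<sigma> = \<Sum>_{i=1}^q (-1)^i (A_{j_i}\<sigma> - B_{j_i}\<sigma>), where j = j_i iff i = rank + 1.\<close>
definition bd_coeff :: "cube \<Rightarrow> cube \<Rightarrow> int" where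
  "bd_coeff \<sigma> \<tau> = (\<Sum>j\<in>{j. j < length (snd \<sigma>) \<and> snd \<sigma> ! j}.
      (-1) ^ Suc (rank (snd \<sigma>) j) *
      ((if \<tau> = face_A j \<sigma> then 1 else 0) - (if \<tau> = face_B j \<sigma> then 1 else 0)))"

text \<open>Rational chains: functions cube => rat, supported on the q-cubes of X.\<close>
definition chains :: "point set \<Rightarrow> nat \<Rightarrow> nat \<Rightarrow> (cube \<Rightarrow> rat) set" where
  "chains X n q = {c. \<forall>\<sigma>. \<sigma> \<notin> cubes X n q \<longrightarrow> c \<sigma> = 0}"

definition bd :: "point set \<Rightarrow> nat \<Rightarrow> nat \<Rightarrow> (cube \<Rightarrow> rat) \<Rightarrow> (cube \<Rightarrow> rat)" where
  "bd X n q c = (\<lambda>\<tau>. \<Sum>\<sigma>\<in>cubes X n q. c \<sigma> * of_int (bd_coeff \<sigma> \<tau>))"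

definition cycles :: "point set \<Rightarrow> nat \<Rightarrow> nat \<Rightarrow> (cube \<Rightarrow> rat) set" where
  "cycles X n q = {c \<in> chains X n q. bd X n q c = (\<lambda>_. 0)}"

definition boundaries :: "point set \<Rightarrow> nat \<Rightarrow> nat \<Rightarrow> (cube \<Rightarrow> rat) set" where
  "boundaries X n q = bd X n (Suc q) ` chains X n (Suc q)"

text \<open>Identification of {0,1}^q with a cube via its nondegenerate coordinates (in increasing order,
  shifted by the minima): coordinate j of emb sigma x is a!j + x(rank j) if j nondegenerate.\<close>
definition emb :: "cube \<Rightarrow> (nat \<Rightarrow> int) \<Rightarrow> point" where
  "emb \<sigma> x = map (\<lambda>j. fst \<sigma> ! j + (if snd \<sigma> ! j then x (rank (snd \<sigma>) j) else 0))
                  [0..<length (fst \<sigma>)]"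

text \<open>f restricted to sigma has the form (x_1..x_q) |-> (y_1..y_q), y_i = x_{pi i} or 1 - x_{pi i}
  (flip e i), for the permutation pi (of {0..<q}).\<close>
definition cube_map_form :: "(point \<Rightarrow> point) \<Rightarrow> cube \<Rightarrow> cube \<Rightarrow> (nat \<Rightarrow> nat) \<Rightarrow> (nat \<Rightarrow> bool) \<Rightarrow> bool" where
  "cube_map_form f \<sigma> \<tau> \<pi> e \<longleftrightarrow> \<pi> permutes {..<cube_dim \<sigma>} \<and>
     (\<forall>x. (\<forall>i. x i \<in> {0,1}) \<longrightarrow>
        f (emb \<sigma> x) = emb \<tau> (\<lambda>i. if e i then 1 - x (\<pi> i) else x (\<pi> i)))"

text \<open>Coefficient of tau in fbar_q(sigma): sgn(pi) (-1)^r if f(sigma) = tau is an elementary cube of the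
  same dimension q, and 0 otherwise.\<close>
definition fbar_coeff :: "nat \<Rightarrow> (point \<Rightarrow> point) \<Rightarrow> cube \<Rightarrow> cube \<Rightarrow> int" where
  "fbar_coeff n f \<sigma> \<tau> =
     (if cube_ok n \<tau> \<and> cube_dim \<tau> = cube_dim \<sigma> \<and> f ` cube_pts \<sigma> = cube_pts \<tau>
         \<and> (\<exists>\<pi> e. cube_map_form f \<sigma> \<tau> \<pi> e)
      then (let (\<pi>, e) = (SOME (\<pi>, e). cube_map_form f \<sigma> \<tau> \<pi> e)
            in sign \<pi> * (-1) ^ card {i. i < cube_dim \<sigma> \<and> e i})
      else 0)"

definition fbar :: "point set \<Rightarrow> nat \<Rightarrow> nat \<Rightarrow> (point \<Rightarrow> point) \<Rightarrow> (cube \<Rightarrow> rat) \<Rightarrow> (cube \<Rightarrow> rat)" where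
  "fbar X n q f c = (\<lambda>\<tau>. \<Sum>\<sigma>\<in>cubes X n q. c \<sigma> * of_int (fbar_coeff n f \<sigma> \<tau>))"

text \<open>Trace of the linear map induced by phi on the quotient V/W of rational vector spaces of
  functions, computed with respect to a basis of V/W represented by vs 0, ..., vs (k-1).\<close>
definition lincomb :: "nat \<Rightarrow> (nat \<Rightarrow> rat) \<Rightarrow> (nat \<Rightarrow> 'a \<Rightarrow> rat) \<Rightarrow> 'a \<Rightarrow> rat" where
  "lincomb k a vs = (\<lambda>t. \<Sum>j<k. a j * vs j t)"

definition quot_basis :: "('a \<Rightarrow> rat) set \<Rightarrow> ('a \<Rightarrow> rat) set \<Rightarrow> nat \<Rightarrow> (nat \<Rightarrow> 'a \<Rightarrow> rat) \<Rightarrow> bool" where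
  "quot_basis V W k vs \<longleftrightarrow> (\<forall>j<k. vs j \<in> V) \<and>
     (\<forall>a. lincomb k a vs \<in> W \<longrightarrow> (\<forall>j<k. a j = 0)) \<and>
     (\<forall>v\<in>V. \<exists>a. v - lincomb k a vs \<in> W)"

definition quot_trace :: "(('a \<Rightarrow> rat) \<Rightarrow> ('a \<Rightarrow> rat)) \<Rightarrow> ('a \<Rightarrow> rat) set \<Rightarrow> ('a \<Rightarrow> rat) set \<Rightarrow> rat" where
  "quot_trace \<phi> V W = (THE t. \<exists>k vs A. quot_basis V W k vs \<and>
      (\<forall>i<k. \<phi> (vs i) - lincomb k (A i) vs \<in> W) \<and> t = (\<Sum>i<k. A i i))"

text \<open>Trace of fbar_{*,q} on H_q(X) \<otimes> Q = Z_q / B_q (rational coefficients).\<close>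
definition homology_trace :: "point set \<Rightarrow> nat \<Rightarrow> (point \<Rightarrow> point) \<Rightarrow> nat \<Rightarrow> rat" where
  "homology_trace X n f q = quot_trace (fbar X n q f) (cycles X n q) (boundaries X n q)"

text \<open>Cubical Lefschetz number; H_q = 0 for q > n since there are no q-cubes then.\<close>
definition lefschetz :: "point set \<Rightarrow> nat \<Rightarrow> (point \<Rightarrow> point) \<Rightarrow> rat" where
  "lefschetz X n f = (\<Sum>q\<le>n. (-1) ^ q * homology_trace X n f q)"

end

theory Submission
  imports Defs "Jordan_Normal_Form.Determinant"
begin

text \<open>If no cube is mapped onto itself, all diagonal coefficients of \<open>fbar\<close> vanish, and the Hopf trace
  formula gives Lefschetz number 0. What has to be shown is that \<open>fbar\<close> is a chain map. A nonzero
  \<open>p\<close>-cycle (reduced, if \<open>p = 0\<close>) has at least \<open>2 ^ (p + 1)\<close> vertices, and if it has exactly that many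
  and they form a connected set, they form a \<open>(p + 1)\<close>-cube. For a \<open>q\<close>-cube \<open>\<sigma>\<close>, induction on \<open>q\<close> shows
  that the image of \<open>\<partial>\<sigma>\<close> is a \<open>(q - 1)\<close>-cycle with vertices in \<open>f \<sigma>\<close>, which is connected and has at
  most \<open>2 ^ q\<close> points. So either this cycle is zero or \<open>f \<sigma>\<close> is a \<open>q\<close>-cube; in the latter case \<open>f\<close>
  restricts to a signed coordinate permutation and the claim is a computation with signs of
  permutations.\<close>

section \<open>Traces on quotients\<close>

text \<open>When \<open>f\<close> does not carry \<sigma> onto a cube of the same dimension, its
  value on \<sigma> is 0, so the chain map identity requires the image of \<partial>\<sigma> to
  vanish. Proving this directly would mean classifying all degenerate images. Counting vertices
  avoids that: the lower bound for a cycle equals the largest possible size of the image, so only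
  the extremal case needs any structure. The reduced condition in dimension 0 excludes a single
  point, which would otherwise be a cycle with one vertex instead of two.

  The trace formula rests on the filtration B \<subseteq> Z \<subseteq> C and on C/Z being
  isomorphic to the B one degree lower: each boundary trace enters two neighbouring degrees and
  cancels in the alternating sum. As \<open>quot_trace\<close> is a \<open>THE\<close>, existence of
  quotient bases and independence of the basis must be established as well.

  Boundaries are treated dually, through the values of cochains on them, and cubes by splitting off
  the first factor, so that geometric inductions run over the ambient dimension.\<close>

definition lin_subspace :: "('a \<Rightarrow> rat) set \<Rightarrow> bool" where
  "lin_subspace V \<longleftrightarrow> (\<lambda>_. 0) \<in> V \<and> (\<forall>v\<in>V. \<forall>w\<in>V. \<forall>a b. (\<lambda>t. a * v t + b * w t) \<in> V)"

definition lin_map :: "(('a \<Rightarrow> rat) \<Rightarrow> ('b \<Rightarrow> rat)) \<Rightarrow> bool" where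
  "lin_map \<phi> \<longleftrightarrow> (\<forall>v w a b. \<phi> (\<lambda>t. a * v t + b * w t) = (\<lambda>t. a * \<phi> v t + b * \<phi> w t))"

text \<open>The relation under the \<open>THE\<close> of \<open>quot_trace\<close>. As a relation it
  can be added and transported between quotients without an appeal to well-definedness at each
  step.\<close>

definition is_quot_trace ::
  "(('a \<Rightarrow> rat) \<Rightarrow> ('a \<Rightarrow> rat)) \<Rightarrow> ('a \<Rightarrow> rat) set \<Rightarrow> ('a \<Rightarrow> rat) set \<Rightarrow> rat \<Rightarrow> bool" where
  "is_quot_trace \<phi> V W t \<longleftrightarrow> (\<exists>k vs A. quot_basis V W k vs \<and>
      (\<forall>i<k. \<phi> (vs i) - lincomb k (A i) vs \<in> W) \<and> t = (\<Sum>i<k. A i i))"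

lemma lin_subspace_comb:
  assumes "lin_subspace V" "v \<in> V" "w \<in> V"
  shows "(\<lambda>t. a * v t + b * w t) \<in> V"
  using assms unfolding lin_subspace_def by blast

lemma lin_subspace_zero: "lin_subspace V \<Longrightarrow> (\<lambda>_. 0) \<in> V"
  by (simp add: lin_subspace_def)

lemma lin_subspace_add:
  assumes "lin_subspace V" "v \<in> V" "w \<in> V"
  shows "(\<lambda>t. v t + w t) \<in> V"
  using lin_subspace_comb[OF assms, of 1 1] by simp

lemma lin_subspace_diff:
  assumes "lin_subspace V" "v \<in> V" "w \<in> V"
  shows "v - w \<in> V"
  using lin_subspace_comb[OF assms, of 1 "-1"] by (simp add: fun_diff_def)

lemma lin_subspace_scale:
  assumes "lin_subspace V" "v \<in> V"
  shows "(\<lambda>t. a * v t) \<in> V"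
  using lin_subspace_comb[OF assms(1) assms(2) assms(2), of a 0] by simp

lemma lin_subspace_trans:
  assumes "lin_subspace W" "u - v \<in> W" "v - w \<in> W"
  shows "u - w \<in> W"
  using lin_subspace_add[OF assms] by (simp add: fun_diff_def)

lemma lin_subspace_sym:
  assumes "lin_subspace W" "u - v \<in> W"
  shows "v - u \<in> W"
  using lin_subspace_scale[OF assms, of "-1"] by (simp add: fun_diff_def)

lemma lin_subspace_lincomb:
  assumes "lin_subspace V" "\<And>j. j < k \<Longrightarrow> vs j \<in> V"
  shows "lincomb k a vs \<in> V"
  using assms(2)
proof (induction k)
  case 0
  then show ?case using assms(1) by (simp add: lincomb_def lin_subspace_zero)
next
  case (Suc k)
  have "lincomb k a vs \<in> V" using Suc by simp
  moreover have "vs k \<in> V" using Suc.prems by simp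
  ultimately have "(\<lambda>t. 1 * lincomb k a vs t + a k * vs k t) \<in> V"
    by (rule lin_subspace_comb[OF assms(1)])
  then show ?case by (simp add: lincomb_def)
qed

lemma lin_map_zero:
  assumes "lin_map \<phi>" shows "\<phi> (\<lambda>_. 0) = (\<lambda>_. 0)"
  using assms[unfolded lin_map_def, rule_format, of 0 "\<lambda>_. 0" 0 "\<lambda>_. 0"] by simp

lemma lin_map_diff:
  assumes "lin_map \<phi>" shows "\<phi> (v - w) = \<phi> v - \<phi> w"
proof -
  have "\<phi> (\<lambda>t. 1 * v t + (-1) * w t) = (\<lambda>t. 1 * \<phi> v t + (-1) * \<phi> w t)"
    using assms unfolding lin_map_def by blast
  then show ?thesis by (simp add: fun_diff_def)
qed

lemma lin_map_lincomb:
  assumes "lin_map \<phi>"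
  shows "\<phi> (lincomb k a vs) = lincomb k a (\<lambda>j. \<phi> (vs j))"
proof (induction k)
  case 0
  then show ?case using lin_map_zero[OF assms] by (simp add: lincomb_def)
next
  case (Suc k)
  have "\<phi> (\<lambda>t. 1 * lincomb k a vs t + a k * vs k t)
      = (\<lambda>t. 1 * \<phi> (lincomb k a vs) t + a k * \<phi> (vs k) t)"
    using assms unfolding lin_map_def by blast
  then show ?case unfolding Suc by (simp add: lincomb_def)
qed

lemma lincomb_diff_vectors:
  assumes "lin_subspace W" "\<And>j. j < k \<Longrightarrow> vs j - us j \<in> W"
  shows "lincomb k a vs - lincomb k a us \<in> W"
proof -
  have "lincomb k a (\<lambda>j. vs j - us j) \<in> W"
    using assms by (rule lin_subspace_lincomb)
  then show ?thesis
    by (simp add: lincomb_def fun_diff_def sum_subtractf right_diff_distrib)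
qed

lemma lincomb_lincomb:
  "lincomb k a (\<lambda>i. lincomb m (P i) us) = lincomb m (\<lambda>j. \<Sum>i<k. a i * P i j) us"
proof
  fix t
  have "(\<Sum>j<k. a j * (\<Sum>i<m. P j i * us i t)) = (\<Sum>j<k. \<Sum>i<m. a j * P j i * us i t)"
    by (simp add: sum_distrib_left mult.assoc)
  also have "\<dots> = (\<Sum>i<m. \<Sum>j<k. a j * P j i * us i t)" by (rule sum.swap)
  finally show "lincomb k a (\<lambda>i. lincomb m (P i) us) t = lincomb m (\<lambda>j. \<Sum>i<k. a i * P i j) us t"
    by (simp add: lincomb_def sum_distrib_right)
qed

lemma lincomb_unit: "i < k \<Longrightarrow> lincomb k (\<lambda>j. if j = i then 1 else 0) vs = vs i"
  by (simp add: lincomb_def fun_eq_iff if_distrib[of "\<lambda>x. x * _"] cong: if_cong)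

lemma quot_basis_coeffs_unique:
  assumes "quot_basis V W k vs" "lincomb k a vs - lincomb k b vs \<in> W" "j < k"
  shows "a j = b j"
proof -
  have "lincomb k (\<lambda>j. a j - b j) vs \<in> W"
    using assms(2) by (simp add: lincomb_def fun_diff_def sum_subtractf left_diff_distrib)
  then have "\<forall>j<k. a j - b j = 0" using assms(1) unfolding quot_basis_def by blast
  then show ?thesis using assms(3) by simp
qed

text \<open>Substituting one expansion into the other expresses \<open>vs i\<close> modulo
  \<open>W\<close> in the basis \<open>vs\<close> itself, and such coefficients are unique.
  Exchanging the roles of the bases gives the other product.\<close>

lemma quot_basis_change_inverse:
  assumes "lin_subspace W" "quot_basis V W k vs"
    and P: "\<And>i. i < k \<Longrightarrow> vs i - lincomb m (P i) us \<in> W"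
    and Q: "\<And>j. j < m \<Longrightarrow> us j - lincomb k (Q j) vs \<in> W"
    and "i < k" "l < k"
  shows "(\<Sum>j<m. P i j * Q j l) = (if l = i then 1 else 0)"
proof -
  have "lincomb m (P i) us - lincomb m (P i) (\<lambda>j. lincomb k (Q j) vs) \<in> W"
    by (rule lincomb_diff_vectors[OF assms(1)]) (rule Q)
  with P[OF \<open>i < k\<close>] have "vs i - lincomb k (\<lambda>l. \<Sum>j<m. P i j * Q j l) vs \<in> W"
    unfolding lincomb_lincomb by (rule lin_subspace_trans[OF assms(1)])
  then have "lincomb k (\<lambda>j. if j = i then 1 else 0) vs
      - lincomb k (\<lambda>l. \<Sum>j<m. P i j * Q j l) vs \<in> W"
    by (simp add: lincomb_unit[OF \<open>i < k\<close>])
  from quot_basis_coeffs_unique[OF assms(2) this \<open>l < k\<close>] show ?thesis by simp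
qed

text \<open>With base change matrices \<open>P\<close> and \<open>Q\<close> one has \<open>P Q = 1\<close>, \<open>Q P = 1\<close> and \<open>A P = P B\<close>, so
  \<open>tr A = tr (A P Q) = tr (P B Q) = tr (B Q P) = tr B\<close>.\<close>
lemma is_quot_trace_unique:
  assumes W: "lin_subspace W" and \<phi>: "lin_map \<phi>" and \<phi>W: "\<And>w. w \<in> W \<Longrightarrow> \<phi> w \<in> W"
    and s: "is_quot_trace \<phi> V W s" and t: "is_quot_trace \<phi> V W t"
  shows "s = t"
proof -
  obtain k vs A where vs: "quot_basis V W k vs"
    and A: "\<And>i. i < k \<Longrightarrow> \<phi> (vs i) - lincomb k (A i) vs \<in> W" and sA: "s = (\<Sum>i<k. A i i)"
    using s unfolding is_quot_trace_def by blast
  obtain m us B where us: "quot_basis V W m us"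
    and B: "\<And>i. i < m \<Longrightarrow> \<phi> (us i) - lincomb m (B i) us \<in> W" and tB: "t = (\<Sum>i<m. B i i)"
    using t unfolding is_quot_trace_def by blast
  have "\<forall>i. \<exists>a. i < k \<longrightarrow> vs i - lincomb m a us \<in> W"
    using vs us unfolding quot_basis_def by meson
  then obtain P where P: "\<And>i. i < k \<Longrightarrow> vs i - lincomb m (P i) us \<in> W" by metis
  have "\<forall>i. \<exists>a. i < m \<longrightarrow> us i - lincomb k a vs \<in> W"
    using vs us unfolding quot_basis_def by meson
  then obtain Q where Q: "\<And>i. i < m \<Longrightarrow> us i - lincomb k (Q i) vs \<in> W" by metis
  have PQ: "(\<Sum>j<m. P i j * Q j l) = (if l = i then 1 else 0)" if "i < k" "l < k" for i l
    using quot_basis_change_inverse[OF W vs P Q that] .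
  have QP: "(\<Sum>j<k. Q i j * P j l) = (if l = i then 1 else 0)" if "i < m" "l < m" for i l
    using quot_basis_change_inverse[OF W us Q P that] .
  \<comment> \<open>Both sides are the coefficients of \<open>\<phi> (vs i)\<close> in the basis
    \<open>us\<close>: apply \<phi> and then change basis, or change basis and then apply \<phi>.
    The second route uses that \<phi> maps \<open>W\<close> into itself.\<close>
  have AP: "(\<Sum>l<k. A i l * P l j) = (\<Sum>l<m. P i l * B l j)" if i: "i < k" and j: "j < m" for i j
  proof -
    have "lincomb k (A i) vs - lincomb k (A i) (\<lambda>l. lincomb m (P l) us) \<in> W"
      by (rule lincomb_diff_vectors[OF W]) (rule P)
    with A[OF i] have 1: "\<phi> (vs i) - lincomb m (\<lambda>j. \<Sum>l<k. A i l * P l j) us \<in> W"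
      unfolding lincomb_lincomb by (rule lin_subspace_trans[OF W])
    have "\<phi> (vs i) - \<phi> (lincomb m (P i) us) \<in> W"
      using \<phi>W[OF P[OF i]] by (simp add: lin_map_diff[OF \<phi>])
    moreover have "lincomb m (P i) (\<lambda>l. \<phi> (us l)) - lincomb m (P i) (\<lambda>l. lincomb m (B l) us) \<in> W"
      by (rule lincomb_diff_vectors[OF W]) (rule B)
    ultimately have 2: "\<phi> (vs i) - lincomb m (\<lambda>j. \<Sum>l<m. P i l * B l j) us \<in> W"
      unfolding lincomb_lincomb lin_map_lincomb[OF \<phi>] by (rule lin_subspace_trans[OF W])
    show ?thesis
      by (rule quot_basis_coeffs_unique[OF us lin_subspace_trans[OF W lin_subspace_sym[OF W 1] 2] j])
  qed
  have "(\<Sum>i<k. \<Sum>j<m. (\<Sum>l<k. A i l * P l j) * Q j i) = (\<Sum>i<k. \<Sum>l<k. A i l * (\<Sum>j<m. P l j * Q j i))"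
  proof (rule sum.cong[OF refl])
    fix i
    show "(\<Sum>j<m. (\<Sum>l<k. A i l * P l j) * Q j i) = (\<Sum>l<k. A i l * (\<Sum>j<m. P l j * Q j i))"
      unfolding sum_distrib_left sum_distrib_right mult.assoc by (rule sum.swap)
  qed
  also have "\<dots> = (\<Sum>i<k. \<Sum>l<k. A i l * (if i = l then 1 else 0))"
    by (intro sum.cong refl) (simp add: PQ)
  also have "\<dots> = s" by (simp add: sA if_distrib[of "\<lambda>x. _ * x"] cong: if_cong)
  finally have s': "(\<Sum>i<k. \<Sum>j<m. (\<Sum>l<k. A i l * P l j) * Q j i) = s" .
  have "(\<Sum>i<k. \<Sum>j<m. (\<Sum>l<m. P i l * B l j) * Q j i) = (\<Sum>j<m. \<Sum>i<k. (\<Sum>l<m. P i l * B l j) * Q j i)"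
    by (rule sum.swap)
  also have "\<dots> = (\<Sum>j<m. \<Sum>l<m. B l j * (\<Sum>i<k. Q j i * P i l))"
  proof (rule sum.cong[OF refl])
    fix j
    have "(\<Sum>i<k. (\<Sum>l<m. P i l * B l j) * Q j i) = (\<Sum>i<k. \<Sum>l<m. B l j * (Q j i * P i l))"
      unfolding sum_distrib_right by (simp add: ac_simps)
    then show "(\<Sum>i<k. (\<Sum>l<m. P i l * B l j) * Q j i) = (\<Sum>l<m. B l j * (\<Sum>i<k. Q j i * P i l))"
      unfolding sum_distrib_left by (simp add: sum.swap[of _ "{..<k}"])
  qed
  also have "\<dots> = (\<Sum>j<m. \<Sum>l<m. B l j * (if l = j then 1 else 0))"
    by (intro sum.cong refl) (simp add: QP)
  also have "\<dots> = t" by (simp add: tB if_distrib[of "\<lambda>x. _ * x"] cong: if_cong)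
  finally have "(\<Sum>i<k. \<Sum>j<m. (\<Sum>l<m. P i l * B l j) * Q j i) = t" .
  moreover have "(\<Sum>i<k. \<Sum>j<m. (\<Sum>l<k. A i l * P l j) * Q j i)
      = (\<Sum>i<k. \<Sum>j<m. (\<Sum>l<m. P i l * B l j) * Q j i)"
    by (intro sum.cong refl) (simp add: AP)
  ultimately show ?thesis using s' by simp
qed

lemma quot_trace_eqI:
  assumes "lin_subspace W" "lin_map \<phi>" "\<And>w. w \<in> W \<Longrightarrow> \<phi> w \<in> W" "is_quot_trace \<phi> V W t"
  shows "quot_trace \<phi> V W = t"
  unfolding quot_trace_def is_quot_trace_def[symmetric]
  using assms(4) is_quot_trace_unique[OF assms(1-3) _ assms(4)] by (rule the_equality)

section \<open>Additivity and existence of traces\<close>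

lemma lincomb_append:
  "lincomb (k + m) a (\<lambda>j. if j < k then vs j else us (j - k))
    = (\<lambda>t. lincomb k a vs t + lincomb m (\<lambda>j. a (k + j)) us t)"
proof
  fix t
  have "(\<Sum>j<k+m. a j * (if j < k then vs j else us (j - k)) t)
     = (\<Sum>j<k. a j * vs j t) + (\<Sum>j\<in>{k..<k+m}. a j * us (j - k) t)"
    by (subst sum.atLeastLessThan_concat[of 0 k "k+m", simplified lessThan_atLeast0[symmetric], symmetric])
       (auto intro!: sum.cong arg_cong2[where f="(+)"])
  also have "(\<Sum>j\<in>{k..<k+m}. a j * us (j - k) t) = (\<Sum>j<m. a (k + j) * us j t)"
    by (rule sum.reindex_bij_witness[of _ "\<lambda>j. k + j" "\<lambda>j. j - k"]) auto
  finally show "lincomb (k + m) a (\<lambda>j. if j < k then vs j else us (j - k)) t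
      = lincomb k a vs t + lincomb m (\<lambda>j. a (k + j)) us t"
    by (simp add: lincomb_def)
qed

text \<open>A basis of \<open>W\<close> modulo \<open>U\<close>, followed by representatives of a
  basis of \<open>V\<close> modulo \<open>W\<close>, is a basis of \<open>V\<close> modulo
  \<open>U\<close>. In it \<phi> is block triangular, so the diagonal sums add.\<close>

lemma is_quot_trace_add:
  assumes U: "lin_subspace U" and W: "lin_subspace W" and "U \<subseteq> W" "W \<subseteq> V"
    and s: "is_quot_trace \<phi> W U s" and t: "is_quot_trace \<phi> V W t"
  shows "is_quot_trace \<phi> V U (s + t)"
proof -
  obtain k vs A where vs: "quot_basis W U k vs"
    and A: "\<And>i. i < k \<Longrightarrow> \<phi> (vs i) - lincomb k (A i) vs \<in> U" and sA: "s = (\<Sum>i<k. A i i)"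
    using s unfolding is_quot_trace_def by blast
  obtain m us B where us: "quot_basis V W m us"
    and B: "\<And>i. i < m \<Longrightarrow> \<phi> (us i) - lincomb m (B i) us \<in> W" and tB: "t = (\<Sum>i<m. B i i)"
    using t unfolding is_quot_trace_def by blast
  define ws where "ws = (\<lambda>j. if j < k then vs j else us (j - k))"
  have vsW: "vs j \<in> W" if "j < k" for j using vs that unfolding quot_basis_def by blast
  have app: "lincomb (k + m) a ws = (\<lambda>t. lincomb k a vs t + lincomb m (\<lambda>j. a (k + j)) us t)" for a
    unfolding ws_def by (rule lincomb_append)
  have span: "\<exists>a. v - lincomb k a vs \<in> U" if "v \<in> W" for v
    using vs that unfolding quot_basis_def by blast
  \<comment> \<open>The matrix \<open>B\<close> describes \<phi> only modulo \<open>W\<close>. The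
    error lies in \<open>W\<close> and is expanded in \<open>vs\<close> modulo \<open>U\<close>; its
    coefficients \<open>D\<close> form the off-diagonal block, which does not meet the
    diagonal.\<close>
  have "\<forall>i. \<exists>a. i < m \<longrightarrow> \<phi> (us i) - lincomb m (B i) us - lincomb k a vs \<in> U"
    using span B by meson
  then obtain D where D: "\<And>i. i < m \<Longrightarrow> \<phi> (us i) - lincomb m (B i) us - lincomb k (D i) vs \<in> U"
    by metis
  have basis: "quot_basis V U (k + m) ws"
    unfolding quot_basis_def
  proof (intro conjI allI impI ballI)
    fix j assume "j < k + m"
    then show "ws j \<in> V"
      using vsW us \<open>W \<subseteq> V\<close> unfolding ws_def quot_basis_def by auto
  next
    fix a j assume a: "lincomb (k + m) a ws \<in> U" and j: "j < k + m"
    have kW: "lincomb k a vs \<in> W" by (rule lin_subspace_lincomb[OF W vsW])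
    have "lincomb (k + m) a ws - lincomb k a vs \<in> W"
      using a kW \<open>U \<subseteq> W\<close> by (intro lin_subspace_diff[OF W]) auto
    then have "lincomb m (\<lambda>j. a (k + j)) us \<in> W" by (simp add: app fun_diff_def)
    then have a0: "\<forall>j<m. a (k + j) = 0" using us unfolding quot_basis_def by blast
    then have "lincomb m (\<lambda>j. a (k + j)) us = (\<lambda>_. 0)" by (simp add: lincomb_def)
    then have "lincomb k a vs \<in> U" using a by (simp add: app)
    then have "\<forall>j<k. a j = 0" using vs unfolding quot_basis_def by blast
    then show "a j = 0" using a0 j
      by (metis add_diff_inverse_nat nat_add_left_cancel_less)
  next
    fix v assume "v \<in> V"
    then obtain b where "v - lincomb m b us \<in> W" using us unfolding quot_basis_def by blast
    then obtain a where a: "v - lincomb m b us - lincomb k a vs \<in> U" using span by blast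
    define c where "c j = (if j < k then a j else b (j - k))" for j
    have "lincomb k c vs = lincomb k a vs" by (simp add: lincomb_def c_def)
    moreover have "lincomb m (\<lambda>j. c (k + j)) us = lincomb m b us" by (simp add: c_def)
    ultimately have "v - lincomb (k + m) c ws = v - lincomb m b us - lincomb k a vs"
      by (simp add: app fun_diff_def algebra_simps)
    then show "\<exists>a. v - lincomb (k + m) a ws \<in> U" using a by metis
  qed
  define C where "C i j = (if i < k then (if j < k then A i j else 0)
      else (if j < k then D (i - k) j else B (i - k) (j - k)))" for i j
  have mat: "\<phi> (ws i) - lincomb (k + m) (C i) ws \<in> U" if "i < k + m" for i
  proof (cases "i < k")
    case True
    have "lincomb k (C i) vs = lincomb k (A i) vs" "lincomb m (\<lambda>j. C i (k + j)) us = (\<lambda>_. 0)"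
      using True by (simp_all add: lincomb_def C_def)
    moreover have "ws i = vs i" using True by (simp add: ws_def)
    ultimately show ?thesis using A[OF True] by (simp add: app)
  next
    case False
    have "lincomb k (C i) vs = lincomb k (D (i - k)) vs"
      "lincomb m (\<lambda>j. C i (k + j)) us = lincomb m (B (i - k)) us"
      using False by (simp_all add: lincomb_def C_def)
    moreover have "ws i = us (i - k)" using False by (simp add: ws_def)
    ultimately have "\<phi> (ws i) - lincomb (k + m) (C i) ws
        = \<phi> (us (i - k)) - lincomb m (B (i - k)) us - lincomb k (D (i - k)) vs"
      by (simp add: app fun_diff_def algebra_simps)
    then show ?thesis using D[of "i - k"] that False by simp
  qed
  have "(\<Sum>i<k+m. C i i) = (\<Sum>i<k. C i i) + (\<Sum>i\<in>{k..<k+m}. C i i)"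
    by (simp add: sum.atLeastLessThan_concat lessThan_atLeast0)
  also have "(\<Sum>i<k. C i i) = s" by (simp add: sA C_def)
  also have "(\<Sum>i\<in>{k..<k+m}. C i i) = (\<Sum>i<m. B i i)"
    by (rule sum.reindex_bij_witness[of _ "\<lambda>j. k + j" "\<lambda>j. j - k"]) (auto simp: C_def)
  finally have "s + t = (\<Sum>i<k+m. C i i)" by (simp add: tB)
  then show ?thesis unfolding is_quot_trace_def using basis mat by blast
qed

text \<open>Induction on the coordinates that may be nonzero. Evaluation at a new coordinate
  \<open>x\<close> has rank at most one on \<open>V\<close> and on \<open>W\<close>, and the
  induction hypothesis applies to the kernels \<open>V0\<close> and \<open>W0\<close>. The quotient
  gains a basis vector exactly when evaluation vanishes on \<open>W\<close> but not on
  \<open>V\<close>.\<close>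

lemma quot_basis_exists:
  assumes "finite S" "lin_subspace V" "lin_subspace W" "W \<subseteq> V"
    and "\<And>v t. v \<in> V \<Longrightarrow> t \<notin> S \<Longrightarrow> v t = 0"
  shows "\<exists>k vs. quot_basis V W k vs"
  using assms
proof (induction S arbitrary: V W rule: finite_induct)
  case empty
  then have "v - lincomb 0 a vs \<in> W" if "v \<in> V" for v a and vs :: "nat \<Rightarrow> 'a \<Rightarrow> rat"
  proof -
    have "v - lincomb 0 a vs = (\<lambda>_. 0)" using empty(4)[OF that] by (simp add: lincomb_def fun_diff_def)
    then show ?thesis using lin_subspace_zero[OF empty(2)] by simp
  qed
  then show ?case unfolding quot_basis_def by blast
next
  case (insert x S)
  note V = insert.prems(1) and W = insert.prems(2)
  define V0 where "V0 = {v \<in> V. v x = 0}"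
  define W0 where "W0 = {v \<in> W. v x = 0}"
  have "lin_subspace V0" "lin_subspace W0"
    using V W unfolding lin_subspace_def V0_def W0_def by auto
  moreover have "W0 \<subseteq> V0" using insert.prems(3) by (auto simp: V0_def W0_def)
  moreover have "v t = 0" if "v \<in> V0" "t \<notin> S" for v t
    using insert.prems(4)[of v t] that by (cases "t = x") (auto simp: V0_def)
  ultimately obtain k vs where vs: "quot_basis V0 W0 k vs"
    using insert.IH[of V0 W0] by blast
  have vsV0: "vs j \<in> V0" if "j < k" for j using vs that unfolding quot_basis_def by blast
  have comb0: "lincomb k a vs x = 0" for a
    using vsV0 by (simp add: lincomb_def V0_def)
  consider "\<exists>w\<in>W. w x \<noteq> 0" | "\<forall>w\<in>W. w x = 0" "\<exists>v\<in>V. v x \<noteq> 0" | "\<forall>v\<in>V. v x = 0"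
    by blast
  then show ?case
  proof cases
    case 1
    \<comment> \<open>Subtracting a multiple of \<open>w\<close> makes any vector of
      \<open>V\<close> vanish at \<open>x\<close> without changing its class modulo
      \<open>W\<close>, so the basis for the kernels still suffices.\<close>
    then obtain w where w: "w \<in> W" "w x \<noteq> 0" by blast
    have "\<exists>a. v - lincomb k a vs \<in> W" if v: "v \<in> V" for v
    proof -
      let ?c = "v x / w x"
      let ?u = "\<lambda>t. 1 * v t + (- ?c) * w t"
      have "?u \<in> V" using lin_subspace_comb[OF V v] w(1) insert.prems(3) by blast
      then have "?u \<in> V0" using w(2) by (simp add: V0_def)
      then obtain a where "?u - lincomb k a vs \<in> W0" using vs unfolding quot_basis_def by blast
      then have "?u - lincomb k a vs \<in> W" by (simp add: W0_def)
      from lin_subspace_comb[OF W this w(1), of 1 ?c]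
      show ?thesis by (intro exI[of _ a]) (simp add: fun_diff_def)
    qed
    moreover have "\<forall>j<k. a j = 0" if "lincomb k a vs \<in> W" for a
      using that comb0[of a] vs unfolding quot_basis_def W0_def by blast
    ultimately have "quot_basis V W k vs"
      using vsV0 unfolding quot_basis_def V0_def by blast
    then show ?thesis by blast
  next
    case 2
    \<comment> \<open>One vector \<open>u\<close> with nonzero value at \<open>x\<close> completes
      the basis; its coefficient is forced by the value at \<open>x\<close>, because all of
      \<open>vs\<close> and \<open>W\<close> vanish there.\<close>
    then obtain u where u: "u \<in> V" "u x \<noteq> 0" by blast
    have WW: "W0 = W" using 2(1) by (auto simp: W0_def)
    define ws where "ws j = (if j < k then vs j else u)" for j
    have app: "lincomb (Suc k) a ws = (\<lambda>t. lincomb k a vs t + a k * u t)" for a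
      by (simp add: lincomb_def ws_def)
    have "quot_basis V W (Suc k) ws"
      unfolding quot_basis_def
    proof (intro conjI allI impI ballI)
      fix j assume "j < Suc k"
      show "ws j \<in> V" using vsV0[of j] u(1) by (auto simp: ws_def V0_def)
    next
      fix a j assume a: "lincomb (Suc k) a ws \<in> W" and j: "j < Suc k"
      then have "lincomb (Suc k) a ws x = 0" using 2(1) by blast
      then have ak: "a k = 0" using u(2) comb0[of a] by (simp add: app)
      then have "lincomb k a vs \<in> W0" using a by (simp add: app WW)
      then have "\<forall>j<k. a j = 0" using vs unfolding quot_basis_def by blast
      then show "a j = 0" using ak j by (auto simp: less_Suc_eq)
    next
      fix v assume v: "v \<in> V"
      let ?c = "v x / u x"
      let ?u = "\<lambda>t. 1 * v t + (- ?c) * u t"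
      have "?u \<in> V0" using lin_subspace_comb[OF V v u(1), of 1 "- ?c"] u(2) by (simp add: V0_def)
      then obtain a where a: "?u - lincomb k a vs \<in> W0" using vs unfolding quot_basis_def by blast
      define b where "b = a(k := ?c)"
      have "lincomb k b vs = lincomb k a vs" by (simp add: lincomb_def b_def)
      then have "v - lincomb (Suc k) b ws = ?u - lincomb k a vs"
        by (simp add: app fun_diff_def b_def algebra_simps)
      then have "v - lincomb (Suc k) b ws \<in> W" using a WW by simp
      then show "\<exists>a. v - lincomb (Suc k) a ws \<in> W" by blast
    qed
    then show ?thesis by blast
  next
    case 3
    then have "V0 = V" "W0 = W" using insert.prems(3) by (auto simp: V0_def W0_def)
    then show ?thesis using vs by blast
  qed
qed

lemma is_quot_trace_exists:
  assumes "finite S" "lin_subspace V" "lin_subspace W" "W \<subseteq> V"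
    and "\<And>v t. v \<in> V \<Longrightarrow> t \<notin> S \<Longrightarrow> v t = 0" and "\<And>v. v \<in> V \<Longrightarrow> \<phi> v \<in> V"
  shows "\<exists>t. is_quot_trace \<phi> V W t"
proof -
  obtain k vs where vs: "quot_basis V W k vs"
    using quot_basis_exists[OF assms(1-4)] assms(5) by blast
  have "\<forall>i. \<exists>a. i < k \<longrightarrow> \<phi> (vs i) - lincomb k a vs \<in> W"
    using vs assms(6) unfolding quot_basis_def by meson
  then obtain A where "\<And>i. i < k \<Longrightarrow> \<phi> (vs i) - lincomb k (A i) vs \<in> W" by metis
  then show ?thesis unfolding is_quot_trace_def using vs by blast
qed

lemma is_quot_trace_lift:
  assumes d: "lin_map d" and comm: "\<And>v. v \<in> V \<Longrightarrow> d (\<phi> v) = \<psi> (d v)"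
    and V: "lin_subspace V" and \<phi>V: "\<And>v. v \<in> V \<Longrightarrow> \<phi> v \<in> V"
    and t: "is_quot_trace \<psi> (d ` V) {\<lambda>_. 0} t"
  shows "is_quot_trace \<phi> V {v \<in> V. d v = (\<lambda>_. 0)} t"
proof -
  obtain k us A where us: "quot_basis (d ` V) {\<lambda>_. 0} k us"
    and A: "\<And>i. i < k \<Longrightarrow> \<psi> (us i) - lincomb k (A i) us \<in> {\<lambda>_. 0}" and tA: "t = (\<Sum>i<k. A i i)"
    using t unfolding is_quot_trace_def by blast
  have "\<forall>i. \<exists>v. i < k \<longrightarrow> v \<in> V \<and> us i = d v" using us unfolding quot_basis_def by blast
  then obtain vs where vs: "\<And>i. i < k \<Longrightarrow> vs i \<in> V" "\<And>i. i < k \<Longrightarrow> us i = d (vs i)" by metis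
  have dcomb: "d (lincomb k a vs) = lincomb k a us" for a
    unfolding lin_map_lincomb[OF d] using vs(2) by (simp add: lincomb_def)
  have combV: "lincomb k a vs \<in> V" for a using V vs(1) by (rule lin_subspace_lincomb)
  have "quot_basis V {v \<in> V. d v = (\<lambda>_. 0)} k vs"
    unfolding quot_basis_def
  proof (intro conjI allI impI ballI)
    fix a j assume "lincomb k a vs \<in> {v \<in> V. d v = (\<lambda>_. 0)}" "j < k"
    then show "a j = 0" using us dcomb unfolding quot_basis_def by auto
  next
    fix v assume v: "v \<in> V"
    then obtain a where a: "d v - lincomb k a us \<in> {\<lambda>_. 0}" using us unfolding quot_basis_def by blast
    then have "d (v - lincomb k a vs) = (\<lambda>_. 0)" by (simp add: lin_map_diff[OF d] dcomb)
    then show "\<exists>a. v - lincomb k a vs \<in> {v \<in> V. d v = (\<lambda>_. 0)}"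
      using lin_subspace_diff[OF V v combV] by blast
  qed (rule vs(1))
  moreover have "\<phi> (vs i) - lincomb k (A i) vs \<in> {v \<in> V. d v = (\<lambda>_. 0)}" if "i < k" for i
    using A[OF that] lin_subspace_diff[OF V \<phi>V[OF vs(1)[OF that]] combV]
    by (simp add: lin_map_diff[OF d] dcomb comm[OF vs(1)[OF that]] vs(2)[OF that])
  ultimately show ?thesis unfolding is_quot_trace_def using tA by blast
qed

section \<open>Boundaries of cubes\<close>

definition nondeg :: "cube \<Rightarrow> nat set" where
  "nondeg \<sigma> = {j. j < length (snd \<sigma>) \<and> snd \<sigma> ! j}"

definition faces :: "cube \<Rightarrow> cube set" where
  "faces \<sigma> = (\<lambda>j. face_A j \<sigma>) ` nondeg \<sigma> \<union> (\<lambda>j. face_B j \<sigma>) ` nondeg \<sigma>"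

text \<open>The value of a cochain on the boundary of a cube.\<close>
definition bdsum :: "cube \<Rightarrow> (cube \<Rightarrow> int) \<Rightarrow> int" where
  "bdsum \<sigma> g = (\<Sum>j\<in>nondeg \<sigma>. (-1) ^ Suc (rank (snd \<sigma>) j) * (g (face_A j \<sigma>) - g (face_B j \<sigma>)))"

text \<open>Product of an elementary interval with \<rho>. Every cube in dimension
  \<open>Suc n\<close> arises this way from one in dimension \<open>n\<close>, which drives the
  inductions below.\<close>

definition lift :: "bool \<Rightarrow> int \<Rightarrow> cube \<Rightarrow> cube" where
  "lift d a \<rho> = (a # fst \<rho>, d # snd \<rho>)"

lemma finite_nondeg [simp]: "finite (nondeg \<sigma>)"
  by (simp add: nondeg_def)

lemma finite_faces [simp]: "finite (faces \<sigma>)"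
  by (simp add: faces_def)

lemma card_nondeg: "card (nondeg \<sigma>) = cube_dim \<sigma>"
  by (simp add: nondeg_def cube_dim_def)

lemma bd_coeff_eq_bdsum: "bd_coeff \<sigma> \<tau> = bdsum \<sigma> (\<lambda>\<rho>. if \<tau> = \<rho> then 1 else 0)"
  by (simp add: bd_coeff_def bdsum_def nondeg_def)

lemma bdsum_cong: "(\<And>\<rho>. \<rho> \<in> faces \<sigma> \<Longrightarrow> g \<rho> = h \<rho>) \<Longrightarrow> bdsum \<sigma> g = bdsum \<sigma> h"
  by (auto simp: bdsum_def faces_def intro!: sum.cong)

lemma bdsum_const [simp]: "bdsum \<sigma> (\<lambda>_. c) = 0"
  by (simp add: bdsum_def)

lemma bdsum_diff: "bdsum \<sigma> (\<lambda>\<rho>. g \<rho> - h \<rho>) = bdsum \<sigma> g - bdsum \<sigma> h"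
  unfolding bdsum_def sum_subtractf[symmetric] by (intro sum.cong refl) (simp add: algebra_simps)

lemma bdsum_mult: "bdsum \<sigma> (\<lambda>\<rho>. g \<rho> * c) = bdsum \<sigma> g * c"
  unfolding bdsum_def sum_distrib_right by (intro sum.cong refl) (simp add: algebra_simps)

lemma bdsum_minus: "bdsum \<sigma> (\<lambda>\<rho>. - g \<rho>) = - bdsum \<sigma> g"
  using bdsum_mult[of \<sigma> g "-1"] by simp

lemma bdsum_sum: "bdsum \<sigma> (\<lambda>\<rho>. \<Sum>t\<in>T. h t \<rho>) = (\<Sum>t\<in>T. bdsum \<sigma> (h t))"
  unfolding bdsum_def sum_subtractf[symmetric] sum_distrib_left by (rule sum.swap)

text \<open>Exchanges matrix products over sets of cubes for values on a boundary. Any finite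
  \<open>T\<close> containing the faces where \<open>g\<close> is nonzero will do, so the faces
  themselves and the cubes of an image are both admissible.\<close>

lemma sum_bd_coeff_mult:
  assumes "finite T" "\<And>\<rho>. \<rho> \<in> faces \<sigma> \<Longrightarrow> \<rho> \<notin> T \<Longrightarrow> g \<rho> = 0"
  shows "(\<Sum>\<tau>\<in>T. bd_coeff \<sigma> \<tau> * g \<tau>) = bdsum \<sigma> g"
proof -
  have "(\<Sum>\<tau>\<in>T. bd_coeff \<sigma> \<tau> * g \<tau>) = bdsum \<sigma> (\<lambda>\<rho>. \<Sum>\<tau>\<in>T. (if \<tau> = \<rho> then 1 else 0) * g \<tau>)"
    by (simp add: bd_coeff_eq_bdsum bdsum_sum bdsum_mult)
  also have "\<dots> = bdsum \<sigma> g"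
    by (rule bdsum_cong) (use assms in \<open>auto simp: if_distrib[of "\<lambda>x. x * _"] sum.delta' cong: if_cong\<close>)
  finally show ?thesis .
qed

section \<open>Products with an interval\<close>

lemma nondeg_lift: "nondeg (lift d a \<rho>) = (if d then {0} else {}) \<union> Suc ` nondeg \<rho>"
proof -
  have "j \<in> nondeg (lift d a \<rho>) \<longleftrightarrow> j \<in> (if d then {0} else {}) \<union> Suc ` nondeg \<rho>" for j
    by (cases j) (auto simp: nondeg_def lift_def)
  then show ?thesis by blast
qed

lemma rank_0 [simp]: "rank d 0 = 0"
  by (simp add: rank_def)

lemma rank_Cons_Suc: "rank (d # ds) (Suc j) = (if d then 1 else 0) + rank ds j"
proof -
  have "{i. i < Suc j \<and> (d # ds) ! i} = (if d then {0} else {}) \<union> Suc ` {i. i < j \<and> ds ! i}"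
    (is "?L = ?R")
  proof -
    have "i \<in> ?L \<longleftrightarrow> i \<in> ?R" for i by (cases i) auto
    then show ?thesis by blast
  qed
  then show ?thesis by (simp add: rank_def card_image)
qed

lemma face_lift [simp]:
  "face_A (Suc j) (lift d a \<rho>) = lift d a (face_A j \<rho>)"
  "face_B (Suc j) (lift d a \<rho>) = lift d a (face_B j \<rho>)"
  "face_A 0 (lift d a \<rho>) = lift False a \<rho>"
  "face_B 0 (lift d a \<rho>) = lift False (a + 1) \<rho>"
  by (simp_all add: face_A_def face_B_def lift_def)

lemma rank_lift: "rank (snd (lift d a \<rho>)) (Suc j) = (if d then 1 else 0) + rank (snd \<rho>) j"
  by (simp add: lift_def rank_Cons_Suc)

text \<open>The Leibniz rule for a product with an interval. The first direction has rank 0, hence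
  sign -1, which yields upper end minus lower end; a nondegenerate first factor raises all later
  ranks by one and so reverses their signs.\<close>

lemma bdsum_lift:
  "bdsum (lift d a \<rho>) g = (if d then g (lift False (a + 1) \<rho>) - g (lift False a \<rho>) else 0)
     + (if d then -1 else 1) * bdsum \<rho> (\<lambda>\<upsilon>. g (lift d a \<upsilon>))"
proof -
  let ?t = "\<lambda>j. (-1) ^ Suc (rank (snd (lift d a \<rho>)) j)
      * (g (face_A j (lift d a \<rho>)) - g (face_B j (lift d a \<rho>)))"
  have "bdsum (lift d a \<rho>) g = sum ?t (if d then {0} else {}) + sum ?t (Suc ` nondeg \<rho>)"
    unfolding bdsum_def nondeg_lift by (rule sum.union_disjoint) auto
  also have "sum ?t (Suc ` nondeg \<rho>) = (if d then -1 else 1) * bdsum \<rho> (\<lambda>\<upsilon>. g (lift d a \<upsilon>))"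
    unfolding bdsum_def sum_distrib_left
    by (subst sum.reindex) (auto simp: rank_lift intro!: sum.cong)
  finally show ?thesis by simp
qed

lemma lift_eq_iff [simp]: "lift d a \<rho> = lift e b \<upsilon> \<longleftrightarrow> d = e \<and> a = b \<and> \<rho> = \<upsilon>"
  by (auto simp: lift_def prod_eq_iff)

text \<open>A face taken in the first direction is degenerate there. Hence a cube that still
  contains the interval at \<open>a\<close> is a face only of cubes with that same interval, and
  only in a later direction.\<close>

lemma bd_coeff_lift_True:
  "bd_coeff (lift d b \<rho>) (lift True a \<upsilon>) = (if d \<and> a = b then - bd_coeff \<rho> \<upsilon> else 0)"
  by (auto simp: bd_coeff_eq_bdsum bdsum_lift)

lemma bd_coeff_lift_False:
  "bd_coeff (lift False b \<rho>) (lift False a \<upsilon>) = (if a = b then bd_coeff \<rho> \<upsilon> else 0)"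
  by (auto simp: bd_coeff_eq_bdsum bdsum_lift)

lemma cube_ok_lift [simp]: "cube_ok (Suc n) (lift d a \<rho>) \<longleftrightarrow> cube_ok n \<rho>"
  by (simp add: cube_ok_def lift_def)

lemma cube_dim_lift [simp]: "cube_dim (lift d a \<rho>) = (if d then 1 else 0) + cube_dim \<rho>"
  unfolding card_nondeg[symmetric] nondeg_lift by (simp add: card_image)

lemma cube_pts_lift:
  "cube_pts (lift d a \<rho>) = (#) a ` cube_pts \<rho> \<union> (if d then (#) (a + 1) ` cube_pts \<rho> else {})"
proof -
  have "x \<in> cube_pts (lift d a \<rho>) \<longleftrightarrow>
      x \<in> (#) a ` cube_pts \<rho> \<union> (if d then (#) (a + 1) ` cube_pts \<rho> else {})" for x
    by (cases x) (auto simp: cube_pts_def lift_def All_less_Suc2)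
  then show ?thesis by blast
qed

lemma cube_ok_0: "cube_ok 0 \<sigma> \<longleftrightarrow> \<sigma> = ([], [])"
  by (auto simp: cube_ok_def prod_eq_iff)

lemma cube_ok_SucE:
  assumes "cube_ok (Suc n) \<sigma>"
  obtains d a \<rho> where "\<sigma> = lift d a \<rho>" "cube_ok n \<rho>"
proof (cases \<sigma>)
  case (Pair as ds)
  then obtain a as' d ds' where "as = a # as'" "ds = d # ds'"
    using assms by (auto simp: cube_ok_def length_Suc_conv)
  with Pair have "\<sigma> = lift d a (as', ds')" by (simp add: lift_def)
  with assms that show thesis by simp
qed

text \<open>The dual form of \<partial>\<partial> = 0. By the Leibniz rule the two ends of the first
  interval occur twice with opposite signs, and what remains is the claim for \<rho>.\<close>

lemma bdsum_bdsum:
  assumes "cube_ok n \<sigma>"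
  shows "bdsum \<sigma> (\<lambda>\<rho>. bdsum \<rho> g) = 0"
  using assms
proof (induction n arbitrary: \<sigma> g)
  case 0
  then have "nondeg \<sigma> = {}" by (simp add: cube_ok_0 nondeg_def)
  then show ?case by (simp add: bdsum_def)
next
  case (Suc n)
  then obtain d a \<rho> where \<sigma>: "\<sigma> = lift d a \<rho>" "cube_ok n \<rho>" by (elim cube_ok_SucE)
  show ?case
    using Suc.IH[OF \<sigma>(2)] by (cases d) (simp_all add: \<sigma>(1) bdsum_lift bdsum_diff bdsum_minus)
qed

lemma finite_cube_pts: "cube_ok n \<sigma> \<Longrightarrow> finite (cube_pts \<sigma>)"
proof (induction n arbitrary: \<sigma>)
  case 0
  then show ?case by (simp add: cube_ok_0 cube_pts_def)
next
  case (Suc n)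
  then show ?case by (elim cube_ok_SucE) (auto simp: cube_pts_lift)
qed

lemma card_cube_pts: "cube_ok n \<sigma> \<Longrightarrow> card (cube_pts \<sigma>) = 2 ^ cube_dim \<sigma>"
proof (induction n arbitrary: \<sigma>)
  case 0
  then show ?case by (simp add: cube_ok_0 cube_pts_def cube_dim_def)
next
  case (Suc n)
  then obtain d a \<rho> where \<sigma>: "\<sigma> = lift d a \<rho>" "cube_ok n \<rho>" by (elim cube_ok_SucE)
  have "card ((#) a ` cube_pts \<rho> \<union> (#) (a + 1) ` cube_pts \<rho>)
      = card ((#) a ` cube_pts \<rho>) + card ((#) (a + 1) ` cube_pts \<rho>)"
    using finite_cube_pts[OF \<sigma>(2)] by (intro card_Un_disjoint) auto
  then show ?case using Suc.IH[OF \<sigma>(2)]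
    by (simp add: \<sigma>(1) cube_pts_lift card_image)
qed

lemma fst_in_cube_pts: "fst \<sigma> \<in> cube_pts \<sigma>"
  by (simp add: cube_pts_def)

lemma cube_pts_inject:
  assumes "cube_ok n \<sigma>" "cube_ok n \<tau>" "cube_pts \<sigma> = cube_pts \<tau>"
  shows "\<sigma> = \<tau>"
  using assms
proof (induction n arbitrary: \<sigma> \<tau>)
  case 0
  then show ?case by (simp add: cube_ok_0)
next
  case (Suc n)
  obtain d a \<rho> where \<sigma>: "\<sigma> = lift d a \<rho>" "cube_ok n \<rho>" using Suc.prems(1) by (elim cube_ok_SucE)
  obtain e b \<upsilon> where \<tau>: "\<tau> = lift e b \<upsilon>" "cube_ok n \<upsilon>" using Suc.prems(2) by (elim cube_ok_SucE)
  have eq: "c # x \<in> cube_pts \<sigma> \<longleftrightarrow> c # x \<in> cube_pts \<tau>" for c x using Suc.prems(3) by simp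
  have eq': "(c = a \<or> d \<and> c = a + 1) \<and> x \<in> cube_pts \<rho> \<longleftrightarrow> (c = b \<or> e \<and> c = b + 1) \<and> x \<in> cube_pts \<upsilon>" for c x
    using eq[of c x] unfolding \<sigma> \<tau> cube_pts_lift by (auto split: if_splits)
  have "(c = a \<or> d \<and> c = a + 1) \<longleftrightarrow> (c = b \<or> e \<and> c = b + 1)" for c
    using eq'[of c] fst_in_cube_pts[of \<rho>] fst_in_cube_pts[of \<upsilon>] by blast
  from this[of a] this[of "a + 1"] this[of b] this[of "b + 1"] have "a = b" "d = e" by auto
  moreover have "x \<in> cube_pts \<rho> \<longleftrightarrow> x \<in> cube_pts \<upsilon>" for x
    using eq'[of a x] eq'[of b x] by blast
  then have "\<rho> = \<upsilon>" using Suc.IH[OF \<sigma>(2) \<tau>(2)] by blast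
  ultimately show ?case by (simp add: \<sigma>(1) \<tau>(1))
qed

lemma faces_props:
  assumes "\<rho> \<in> faces \<sigma>"
  shows "cube_ok n \<sigma> \<Longrightarrow> cube_ok n \<rho>" "cube_dim \<sigma> = Suc (cube_dim \<rho>)" "cube_pts \<rho> \<subseteq> cube_pts \<sigma>"
proof -
  obtain j where j: "j \<in> nondeg \<sigma>" "\<rho> = face_A j \<sigma> \<or> \<rho> = face_B j \<sigma>"
    using assms by (auto simp: faces_def)
  show "cube_ok n \<sigma> \<Longrightarrow> cube_ok n \<rho>"
    using j by (auto simp: cube_ok_def face_A_def face_B_def)
  have "nondeg \<rho> = nondeg \<sigma> - {j}"
    using j by (auto simp: nondeg_def face_A_def face_B_def nth_list_update split: if_splits)
  then show "cube_dim \<sigma> = Suc (cube_dim \<rho>)"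
    unfolding card_nondeg[symmetric] using j(1) card_Suc_Diff1[of "nondeg \<sigma>" j] by simp
  show "cube_pts \<rho> \<subseteq> cube_pts \<sigma>"
  proof
    fix x assume x: "x \<in> cube_pts \<rho>"
    have len: "length (fst \<rho>) = length (fst \<sigma>)" using j(2) by (auto simp: face_A_def face_B_def)
    have "x ! i = fst \<sigma> ! i \<or> snd \<sigma> ! i \<and> x ! i = fst \<sigma> ! i + 1" if "i < length (fst \<sigma>)" for i
    proof -
      have "x ! i = fst \<rho> ! i \<or> snd \<rho> ! i \<and> x ! i = fst \<rho> ! i + 1"
        using x that len by (simp add: cube_pts_def)
      then show ?thesis using j that
        by (cases "i = j") (auto simp: face_A_def face_B_def nondeg_def)
    qed
    then show "x \<in> cube_pts \<sigma>" using x len by (simp add: cube_pts_def)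
  qed
qed

section \<open>Vertices of cycles\<close>

text \<open>Connectedness by cuts instead of paths: an edge leaves every proper nonempty part. Cuts
  pull back along maps and projections, so this form passes easily to images and to slices.\<close>

definition cut_connected :: "point set \<Rightarrow> bool" where
  "cut_connected V \<longleftrightarrow> (\<forall>U\<subseteq>V. U \<noteq> {} \<longrightarrow> U \<noteq> V \<longrightarrow> (\<exists>u\<in>U. \<exists>v\<in>V - U. c1_adj u v))"

lemma c1_adj_Cons:
  "c1_adj (a # x) (b # y) \<longleftrightarrow> (\<bar>a - b\<bar> = 1 \<and> x = y) \<or> (a = b \<and> c1_adj x y)"
proof
  assume "c1_adj (a # x) (b # y)"
  then obtain i where i: "i < Suc (length x)" "\<bar>(a # x) ! i - (b # y) ! i\<bar> = 1" "length x = length y"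
    "\<And>j. j < Suc (length x) \<Longrightarrow> j \<noteq> i \<Longrightarrow> (a # x) ! j = (b # y) ! j"
    by (auto simp: c1_adj_def)
  show "(\<bar>a - b\<bar> = 1 \<and> x = y) \<or> (a = b \<and> c1_adj x y)"
  proof (cases i)
    case 0
    have "x = y" using i(3) i(4)[of "Suc _"] 0 by (auto intro!: nth_equalityI)
    then show ?thesis using i(2) 0 by simp
  next
    case (Suc k)
    have "a = b" using i(4)[of 0] Suc by simp
    moreover have "x ! j = y ! j" if "j < length x" "j \<noteq> k" for j using i(4)[of "Suc j"] that Suc by simp
    ultimately show ?thesis using i Suc by (auto simp: c1_adj_def)
  qed
next
  assume "(\<bar>a - b\<bar> = 1 \<and> x = y) \<or> (a = b \<and> c1_adj x y)"
  then show "c1_adj (a # x) (b # y)"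
  proof
    assume "\<bar>a - b\<bar> = 1 \<and> x = y"
    then show ?thesis unfolding c1_adj_def by (auto simp: nth_Cons' intro!: exI[of _ 0])
  next
    assume *: "a = b \<and> c1_adj x y"
    then obtain i where "i < length x" "\<bar>x ! i - y ! i\<bar> = 1" "length x = length y"
      "\<forall>j<length x. j \<noteq> i \<longrightarrow> x ! j = y ! j"
      by (auto simp: c1_adj_def)
    then show ?thesis using * unfolding c1_adj_def by (auto simp: nth_Cons' intro!: exI[of _ "Suc i"])
  qed
qed

text \<open>Provides the cube for the extremal case of the vertex count in dimension 0, where two
  adjacent points have to be recognized as an edge.\<close>

lemma c1_adj_imp_cube:
  assumes "c1_adj x y" "length x = n"
  shows "\<exists>\<tau>. cube_ok n \<tau> \<and> cube_dim \<tau> = 1 \<and> cube_pts \<tau> = {x, y}"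
  using assms
proof (induction n arbitrary: x y)
  case 0
  then show ?case by (simp add: c1_adj_def)
next
  case (Suc n)
  obtain a x' where x: "x = a # x'" "length x' = n" using Suc.prems by (cases x) auto
  obtain b y' where y: "y = b # y'" using Suc.prems x by (cases y) (auto simp: c1_adj_def)
  from Suc.prems(1) consider "\<bar>a - b\<bar> = 1" "x' = y'" | "a = b" "c1_adj x' y'"
    unfolding x y c1_adj_Cons by blast
  then show ?case
  proof cases
    case 1
    define \<rho> :: cube where "\<rho> = (x', replicate n False)"
    have pts: "cube_pts \<rho> = {x'}"
      using x(2) by (auto simp: \<rho>_def cube_pts_def intro: nth_equalityI)
    have "cube_ok n \<rho>" "cube_dim \<rho> = 0"
      using x(2) by (auto simp: \<rho>_def cube_ok_def cube_dim_def)
    moreover have "cube_pts (lift True (min a b) \<rho>) = {x, y}"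
    proof -
      have "min a b = a \<and> min a b + 1 = b \<or> min a b = b \<and> min a b + 1 = a" using 1(1) by linarith
      then show ?thesis unfolding cube_pts_lift pts x y using 1(2) by auto
    qed
    ultimately show ?thesis by (intro exI[of _ "lift True (min a b) \<rho>"]) simp
  next
    case 2
    then obtain \<rho> where \<rho>: "cube_ok n \<rho>" "cube_dim \<rho> = 1" "cube_pts \<rho> = {x', y'}"
      using Suc.IH x(2) by blast
    then show ?thesis using 2(1)
      by (intro exI[of _ "lift False a \<rho>"]) (simp add: cube_pts_lift x y)
  qed
qed

text \<open>Either some edge in the first direction already crosses the cut, or membership in
  \<open>U\<close> does not depend on the first coordinate. In the latter case \<open>U\<close>
  comes from a cut \<open>W\<close> of \<rho>.\<close>

lemma cut_connected_cube: "cube_ok n \<sigma> \<Longrightarrow> cut_connected (cube_pts \<sigma>)"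
proof (induction n arbitrary: \<sigma>)
  case 0
  then show ?case by (auto simp: cube_ok_0 cube_pts_def cut_connected_def)
next
  case (Suc n)
  then obtain d a \<rho> where \<sigma>: "\<sigma> = lift d a \<rho>" "cube_ok n \<rho>" by (elim cube_ok_SucE)
  show ?case unfolding cut_connected_def
  proof (intro allI impI)
    fix U assume U: "U \<subseteq> cube_pts \<sigma>" "U \<noteq> {}" "U \<noteq> cube_pts \<sigma>"
    define W where "W = {v. a # v \<in> U}"
    show "\<exists>u\<in>U. \<exists>v\<in>cube_pts \<sigma> - U. c1_adj u v"
    proof (cases "d \<and> (\<exists>v\<in>cube_pts \<rho>. (a # v \<in> U) \<noteq> ((a + 1) # v \<in> U))")
      case True
      then obtain v where "v \<in> cube_pts \<rho>" "(a # v \<in> U) \<noteq> ((a + 1) # v \<in> U)" "d" by blast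
      moreover have "c1_adj (a # v) ((a + 1) # v)" "c1_adj ((a + 1) # v) (a # v)"
        by (simp_all add: c1_adj_Cons)
      ultimately show ?thesis unfolding \<sigma>(1) cube_pts_lift by (cases "a # v \<in> U") auto
    next
      case False
      have mem: "b # v \<in> U \<longleftrightarrow> v \<in> W" if "b # v \<in> cube_pts \<sigma>" for b v
        using False that by (auto simp: W_def \<sigma>(1) cube_pts_lift split: if_splits)
      have hd: "\<exists>b v. x = b # v \<and> v \<in> cube_pts \<rho>" if "x \<in> cube_pts \<sigma>" for x
        using that by (auto simp: \<sigma>(1) cube_pts_lift split: if_splits)
      have in\<sigma>: "a # v \<in> cube_pts \<sigma>" if "v \<in> cube_pts \<rho>" for v
        using that by (simp add: \<sigma>(1) cube_pts_lift)
      have "W \<subseteq> cube_pts \<rho>" using U(1) hd unfolding W_def by blast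
      moreover have "W \<noteq> {}" using U(1,2) hd mem by blast
      moreover have "W \<noteq> cube_pts \<rho>" using U(1,3) hd mem by blast
      ultimately obtain u v where uv: "u \<in> W" "v \<in> cube_pts \<rho>" "v \<notin> W" "c1_adj u v"
        using Suc.IH[OF \<sigma>(2)] unfolding cut_connected_def by blast
      have "c1_adj (a # u) (a # v)" using uv(4) by (simp add: c1_adj_Cons)
      then show ?thesis using uv in\<sigma> unfolding W_def by blast
    qed
  qed
qed

text \<open>A cut of \<open>V\<close> is repeated in every copy. An edge crossing the repeated cut
  cannot run in the first direction, since that would leave the tail unchanged, so it projects to an
  edge crossing the original cut.\<close>

lemma cut_connected_Cons_imageD:
  assumes "cut_connected ((\<Union>a\<in>A. (#) a ` V))" "A \<noteq> {}"
  shows "cut_connected V"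
  unfolding cut_connected_def
proof (intro allI impI)
  fix U assume U: "U \<subseteq> V" "U \<noteq> {}" "U \<noteq> V"
  have "(\<Union>a\<in>A. (#) a ` U) \<subseteq> (\<Union>a\<in>A. (#) a ` V)" "(\<Union>a\<in>A. (#) a ` U) \<noteq> {}" using U assms(2) by auto
  moreover have "(\<Union>a\<in>A. (#) a ` U) \<noteq> (\<Union>a\<in>A. (#) a ` V)"
  proof
    assume eq: "(\<Union>a\<in>A. (#) a ` U) = (\<Union>a\<in>A. (#) a ` V)"
    obtain v b where "v \<in> V" "v \<notin> U" "b \<in> A" using U assms(2) by blast
    then have "b # v \<in> (\<Union>a\<in>A. (#) a ` U)" unfolding eq by blast
    with \<open>v \<notin> U\<close> show False by auto
  qed
  ultimately obtain x y where xy: "x \<in> (\<Union>a\<in>A. (#) a ` U)" "y \<in> (\<Union>a\<in>A. (#) a ` V)"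
    "y \<notin> (\<Union>a\<in>A. (#) a ` U)" "c1_adj x y"
    using assms(1) unfolding cut_connected_def by (metis DiffD1 DiffD2)
  then obtain a u b v where "x = a # u" "u \<in> U" "b \<in> A" "y = b # v" "v \<in> V" by blast
  moreover have "v \<notin> U" using xy(3) \<open>b \<in> A\<close> \<open>y = b # v\<close> by blast
  ultimately have "x = a # u" "u \<in> U" "y = b # v" "v \<in> V" "v \<notin> U" by simp_all
  with xy(4) show "\<exists>u\<in>U. \<exists>v\<in>V - U. c1_adj u v" by (auto simp: c1_adj_Cons)
qed

text \<open>A nonzero cycle, reduced if \<open>p = 0\<close>, whose support is exactly
  \<open>S\<close>. The set \<open>V\<close> only has to contain its vertices: this freedom lets the
  bound be applied to the whole image of a cube.\<close>

definition cycle_in :: "nat \<Rightarrow> nat \<Rightarrow> point set \<Rightarrow> cube set \<Rightarrow> (cube \<Rightarrow> int) \<Rightarrow> bool" where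
  "cycle_in n p V S z \<longleftrightarrow> finite S \<and> S \<noteq> {} \<and>
     (\<forall>\<sigma>\<in>S. cube_ok n \<sigma> \<and> cube_dim \<sigma> = p \<and> cube_pts \<sigma> \<subseteq> V \<and> z \<sigma> \<noteq> 0) \<and>
     (\<forall>\<tau>. (\<Sum>\<sigma>\<in>S. z \<sigma> * bd_coeff \<sigma> \<tau>) = 0) \<and> (p = 0 \<longrightarrow> (\<Sum>\<sigma>\<in>S. z \<sigma>) = 0)"

text \<open>Cycles pair to zero with coboundaries; here the cochain \<open>w\<close> is arbitrary.
  Used to find the coefficient sum of a slice.\<close>

lemma cycle_bdsum:
  assumes "finite S" "\<And>\<tau>. (\<Sum>\<sigma>\<in>S. z \<sigma> * bd_coeff \<sigma> \<tau>) = 0"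
  shows "(\<Sum>\<sigma>\<in>S. z \<sigma> * bdsum \<sigma> w) = 0"
proof -
  let ?T = "\<Union>\<sigma>\<in>S. faces \<sigma>"
  have "(\<Sum>\<sigma>\<in>S. z \<sigma> * bdsum \<sigma> w) = (\<Sum>\<sigma>\<in>S. z \<sigma> * (\<Sum>\<tau>\<in>?T. bd_coeff \<sigma> \<tau> * w \<tau>))"
    using assms(1) by (intro sum.cong refl) (subst sum_bd_coeff_mult, auto)
  also have "\<dots> = (\<Sum>\<tau>\<in>?T. (\<Sum>\<sigma>\<in>S. z \<sigma> * bd_coeff \<sigma> \<tau>) * w \<tau>)"
    unfolding sum_distrib_left sum_distrib_right by (subst sum.swap) (simp add: mult.assoc)
  also have "\<dots> = 0" using assms(2) by simp
  finally show ?thesis .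
qed

section \<open>Slices of cycles\<close>

lemma sum_lift_slice:
  assumes "finite S" and "\<And>\<sigma>. \<sigma> \<in> S \<Longrightarrow> \<sigma> \<notin> range (lift d a) \<Longrightarrow> h \<sigma> = 0"
  shows "(\<Sum>\<sigma>\<in>S. h \<sigma>) = (\<Sum>\<rho>\<in>{\<rho>. lift d a \<rho> \<in> S}. (h (lift d a \<rho>) :: int))"
proof -
  have "(\<Sum>\<sigma>\<in>S. h \<sigma>) = (\<Sum>\<sigma>\<in>lift d a ` {\<rho>. lift d a \<rho> \<in> S}. h \<sigma>)"
  proof (rule sum.mono_neutral_right[OF assms(1)])
    show "\<forall>\<sigma>\<in>S - lift d a ` {\<rho>. lift d a \<rho> \<in> S}. h \<sigma> = 0" using assms(2) by blast
  qed auto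
  also have "\<dots> = (\<Sum>\<rho>\<in>{\<rho>. lift d a \<rho> \<in> S}. h (lift d a \<rho>))"
    by (subst sum.reindex) (auto simp: inj_on_def)
  finally show ?thesis .
qed

lemma finite_lift_slice: "finite S \<Longrightarrow> finite {\<rho>. lift d a \<rho> \<in> S}"
  using finite_vimageI[of S "lift d a"] by (simp add: vimage_def inj_def)

text \<open>The cubes of \<open>S\<close> crossing the hyperplane at height a + 1/2 are the only
  ones with faces that cross it too, so those faces must cancel among the crossing cubes alone. Both
  ends of a crossing cube lie in \<open>V\<close>, which explains the vertex set.\<close>

lemma cycle_in_slice:
  assumes "cycle_in (Suc n) (Suc p) V S z" "lift True a \<rho> \<in> S"
  shows "cycle_in n p {v. a # v \<in> V \<and> (a + 1) # v \<in> V} {\<rho>. lift True a \<rho> \<in> S} (\<lambda>\<rho>. z (lift True a \<rho>))"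
proof -
  have S: "finite S" "\<And>\<sigma>. \<sigma> \<in> S \<Longrightarrow> cube_ok (Suc n) \<sigma>" and z: "\<And>\<tau>. (\<Sum>\<sigma>\<in>S. z \<sigma> * bd_coeff \<sigma> \<tau>) = 0"
    using assms(1) by (auto simp: cycle_in_def)
  have cyc: "(\<Sum>\<rho>\<in>{\<rho>. lift True a \<rho> \<in> S}. z (lift True a \<rho>) * bd_coeff \<rho> \<tau>) = 0" for \<tau>
  proof -
    have "(\<Sum>\<sigma>\<in>S. z \<sigma> * bd_coeff \<sigma> (lift True a \<tau>))
        = (\<Sum>\<rho>\<in>{\<rho>. lift True a \<rho> \<in> S}. z (lift True a \<rho>) * bd_coeff (lift True a \<rho>) (lift True a \<tau>))"
    proof (rule sum_lift_slice[OF S(1)])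
      fix \<sigma> assume \<sigma>: "\<sigma> \<in> S" "\<sigma> \<notin> range (lift True a)"
      obtain d b \<upsilon> where "\<sigma> = lift d b \<upsilon>" using S(2)[OF \<sigma>(1)] by (elim cube_ok_SucE)
      moreover from this have "\<not> (d \<and> b = a)" using \<sigma>(2) by auto
      ultimately show "z \<sigma> * bd_coeff \<sigma> (lift True a \<tau>) = 0" by (auto simp: bd_coeff_lift_True)
    qed
    then show ?thesis using z by (simp add: bd_coeff_lift_True sum_negf)
  qed
  \<comment> \<open>The indicator of a half-space. Its coboundary is -1 on the cubes crossing at
    \<open>a\<close> and 0 on all others, so pairing it with the cycle counts signed crossings. This
    gives the reduced condition when the slice has dimension 0.\<close>
  define w :: "cube \<Rightarrow> int" where "w \<tau> = (if hd (fst \<tau>) \<le> a then 1 else 0)" for \<tau>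
  have w: "bdsum (lift d b \<upsilon>) w = (if d \<and> b = a then -1 else 0)" for d b \<upsilon>
  proof -
    have "w (lift e c \<rho>) = (if c \<le> a then 1 else 0)" for e c \<rho> by (simp add: w_def lift_def)
    then show ?thesis by (simp add: bdsum_lift)
  qed
  have "(\<Sum>\<sigma>\<in>S. z \<sigma> * bdsum \<sigma> w)
        = (\<Sum>\<rho>\<in>{\<rho>. lift True a \<rho> \<in> S}. z (lift True a \<rho>) * bdsum (lift True a \<rho>) w)"
  proof (rule sum_lift_slice[OF S(1)])
    fix \<sigma> assume \<sigma>: "\<sigma> \<in> S" "\<sigma> \<notin> range (lift True a)"
    obtain d b \<upsilon> where "\<sigma> = lift d b \<upsilon>" using S(2)[OF \<sigma>(1)] by (elim cube_ok_SucE)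
    moreover from this have "\<not> (d \<and> b = a)" using \<sigma>(2) by auto
    ultimately show "z \<sigma> * bdsum \<sigma> w = 0" by (auto simp: w)
  qed
  then have "(\<Sum>\<rho>\<in>{\<rho>. lift True a \<rho> \<in> S}. z (lift True a \<rho>)) = 0"
    using cycle_bdsum[OF S(1) z, of w] by (simp add: w sum_negf)
  moreover have "cube_ok n \<rho> \<and> cube_dim \<rho> = p \<and> cube_pts \<rho> \<subseteq> {v. a # v \<in> V \<and> (a + 1) # v \<in> V}
      \<and> z (lift True a \<rho>) \<noteq> 0" if "lift True a \<rho> \<in> S" for \<rho>
  proof -
    have "cube_ok (Suc n) (lift True a \<rho>) \<and> cube_dim (lift True a \<rho>) = Suc p
        \<and> cube_pts (lift True a \<rho>) \<subseteq> V \<and> z (lift True a \<rho>) \<noteq> 0"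
      using assms(1) that unfolding cycle_in_def by blast
    then show ?thesis by (auto simp: cube_pts_lift)
  qed
  moreover have "{\<rho>. lift True a \<rho> \<in> S} \<noteq> {}" using assms(2) by blast
  ultimately show ?thesis
    using cyc finite_lift_slice[OF S(1)] by (simp add: cycle_in_def)
qed

text \<open>With no cube extended in the first direction, different levels share no faces, and each
  level is a cycle by itself. For \<open>p = 0\<close> this would fail, since the zero coefficient
  sum need not hold level by level.\<close>

lemma cycle_in_level:
  assumes "cycle_in (Suc n) p V S z" "p \<noteq> 0" "lift False a \<rho> \<in> S"
    and flat: "\<And>b \<upsilon>. lift True b \<upsilon> \<notin> S"
  shows "cycle_in n p {v. a # v \<in> V} {\<rho>. lift False a \<rho> \<in> S} (\<lambda>\<rho>. z (lift False a \<rho>))"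
proof -
  have S: "finite S" "\<And>\<sigma>. \<sigma> \<in> S \<Longrightarrow> cube_ok (Suc n) \<sigma>" and z: "\<And>\<tau>. (\<Sum>\<sigma>\<in>S. z \<sigma> * bd_coeff \<sigma> \<tau>) = 0"
    using assms(1) by (auto simp: cycle_in_def)
  have cyc: "(\<Sum>\<rho>\<in>{\<rho>. lift False a \<rho> \<in> S}. z (lift False a \<rho>) * bd_coeff \<rho> \<tau>) = 0" for \<tau>
  proof -
    have "(\<Sum>\<sigma>\<in>S. z \<sigma> * bd_coeff \<sigma> (lift False a \<tau>))
        = (\<Sum>\<rho>\<in>{\<rho>. lift False a \<rho> \<in> S}. z (lift False a \<rho>) * bd_coeff (lift False a \<rho>) (lift False a \<tau>))"
    proof (rule sum_lift_slice[OF S(1)])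
      fix \<sigma> assume \<sigma>: "\<sigma> \<in> S" "\<sigma> \<notin> range (lift False a)"
      obtain d b \<upsilon> where *: "\<sigma> = lift d b \<upsilon>" using S(2)[OF \<sigma>(1)] by (elim cube_ok_SucE)
      have "\<not> d" using \<sigma>(1) flat * by (cases d) simp_all
      moreover from this have "b \<noteq> a" using \<sigma>(2) * by auto
      ultimately have "\<not> d" "b \<noteq> a" by simp_all
      with * show "z \<sigma> * bd_coeff \<sigma> (lift False a \<tau>) = 0" by (simp add: bd_coeff_lift_False)
    qed
    then show ?thesis using z by (simp add: bd_coeff_lift_False)
  qed
  moreover have "cube_ok n \<rho> \<and> cube_dim \<rho> = p \<and> cube_pts \<rho> \<subseteq> {v. a # v \<in> V}
      \<and> z (lift False a \<rho>) \<noteq> 0" if "lift False a \<rho> \<in> S" for \<rho>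
  proof -
    have "cube_ok (Suc n) (lift False a \<rho>) \<and> cube_dim (lift False a \<rho>) = p
        \<and> cube_pts (lift False a \<rho>) \<subseteq> V \<and> z (lift False a \<rho>) \<noteq> 0"
      using assms(1) that unfolding cycle_in_def by blast
    then show ?thesis by (auto simp: cube_pts_lift)
  qed
  moreover have "{\<rho>. lift False a \<rho> \<in> S} \<noteq> {}" using assms(3) by blast
  ultimately show ?thesis
    using assms(2) finite_lift_slice[OF S(1)] by (simp add: cycle_in_def)
qed

text \<open>A single point with nonzero coefficient cannot have coefficient sum 0, so there are two.
  If these are all of \<open>V\<close>, the cut separating them must be crossed by an edge.\<close>

lemma zero_cycle_vertices:
  assumes "cycle_in n 0 V S z" "finite V"
  shows "2 \<le> card V \<and>
    (card V = 2 \<and> cut_connected V \<longrightarrow> (\<exists>\<tau>. cube_ok n \<tau> \<and> cube_dim \<tau> = 1 \<and> cube_pts \<tau> = V))"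
proof -
  have S: "finite S" "S \<noteq> {}" "(\<Sum>\<sigma>\<in>S. z \<sigma>) = 0"
    "\<And>\<sigma>. \<sigma> \<in> S \<Longrightarrow> cube_ok n \<sigma> \<and> cube_dim \<sigma> = 0 \<and> cube_pts \<sigma> \<subseteq> V \<and> z \<sigma> \<noteq> 0"
    using assms(1) by (auto simp: cycle_in_def)
  obtain \<sigma> where \<sigma>: "\<sigma> \<in> S" using S(2) by blast
  have "S \<noteq> {\<sigma>}" using S(3) S(4)[OF \<sigma>] by auto
  then obtain \<tau> where \<tau>: "\<tau> \<in> S" "\<tau> \<noteq> \<sigma>" using \<sigma> by blast
  have single: "cube_pts \<upsilon> = {fst \<upsilon>}" if "\<upsilon> \<in> S" for \<upsilon>
  proof -
    have "card (cube_pts \<upsilon>) = 1" using card_cube_pts S(4)[OF that] by fastforce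
    then obtain x where "cube_pts \<upsilon> = {x}" by (rule card_1_singletonE)
    then show ?thesis using fst_in_cube_pts[of \<upsilon>] by simp
  qed
  have "fst \<sigma> \<noteq> fst \<tau>"
    using cube_pts_inject[of n \<sigma> \<tau>] S(4)[OF \<sigma>] S(4)[OF \<tau>(1)] single[OF \<sigma>] single[OF \<tau>(1)] \<tau>(2) by auto
  moreover have sub: "{fst \<sigma>, fst \<tau>} \<subseteq> V" 
    using S(4)[OF \<sigma>] S(4)[OF \<tau>(1)] single[OF \<sigma>] single[OF \<tau>(1)] by simp
  ultimately have two: "card {fst \<sigma>, fst \<tau>} = 2" by simp
  have "\<exists>\<kappa>. cube_ok n \<kappa> \<and> cube_dim \<kappa> = 1 \<and> cube_pts \<kappa> = V" if "card V = 2" "cut_connected V"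
  proof -
    have V: "V = {fst \<sigma>, fst \<tau>}" using card_subset_eq[OF assms(2) sub] two that(1) by simp
    have "\<exists>u\<in>{fst \<sigma>}. \<exists>v\<in>V - {fst \<sigma>}. c1_adj u v"
      by (rule that(2)[unfolded cut_connected_def, rule_format])
        (use V \<open>fst \<sigma> \<noteq> fst \<tau>\<close> in auto)
    then have "c1_adj (fst \<sigma>) (fst \<tau>)" using V by auto
    then show ?thesis using c1_adj_imp_cube[of _ _ n] S(4)[OF \<sigma>] V by (auto simp: cube_ok_def)
  qed
  then show ?thesis using card_mono[OF assms(2) sub] two by simp
qed

text \<open>Slicing a \<open>p\<close>-cycle at height \<open>a + 1/2\<close> in the first coordinate gives a \<open>(p-1)\<close>-cycle, each of whose
  vertices accounts for two vertices of the original cycle. Connectedness is only needed for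
  \<open>p = 0\<close>, where two vertices need not span an edge.\<close>
lemma cycle_vertices:
  assumes "cycle_in n p V S z" "finite V"
  shows "2 ^ Suc p \<le> card V \<and> (card V = 2 ^ Suc p \<and> cut_connected V \<longrightarrow>
    (\<exists>\<tau>. cube_ok n \<tau> \<and> cube_dim \<tau> = Suc p \<and> cube_pts \<tau> = V))"
  using assms
proof (induction n arbitrary: p V S z)
  case 0
  have "p = 0" using 0(1) unfolding cycle_in_def cube_ok_0 by (auto simp: cube_dim_def)
  then show ?case using zero_cycle_vertices[of 0 V S z] 0 by simp
next
  case (Suc n)
  note cyc = Suc.prems(1) and fin = Suc.prems(2)
  show ?case
  proof (cases p)
    case 0
    then show ?thesis using zero_cycle_vertices[of "Suc n" V S z] Suc.prems by simp
  next
    case p: (Suc p')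
    show ?thesis
    proof (cases "\<exists>a \<rho>. lift True a \<rho> \<in> S")
      case True
      then obtain a \<rho> where "lift True a \<rho> \<in> S" by blast
      define V' where "V' = {v. a # v \<in> V \<and> (a + 1) # v \<in> V}"
      have V': "cycle_in n p' V' {\<rho>. lift True a \<rho> \<in> S} (\<lambda>\<rho>. z (lift True a \<rho>))"
        using cycle_in_slice cyc \<open>lift True a \<rho> \<in> S\<close> unfolding p V'_def by blast
      let ?W = "\<Union>b\<in>{a, a + 1}. (#) b ` V'"
      have sub: "?W \<subseteq> V" by (auto simp: V'_def)
      have finV': "finite V'"
        using finite_subset[OF sub fin] by (auto dest!: finite_imageD)
      have "card ?W = card ((#) a ` V') + card ((#) (a + 1) ` V')"
        using finV' by (simp, intro card_Un_disjoint) auto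
      then have cW: "card ?W = 2 * card V'" by (simp add: card_image)
      note IH = Suc.IH[OF V' finV']
      have ge: "2 ^ Suc p \<le> card ?W" unfolding cW p using IH by simp
      have "\<exists>\<tau>. cube_ok (Suc n) \<tau> \<and> cube_dim \<tau> = Suc p \<and> cube_pts \<tau> = V"
        if "card V = 2 ^ Suc p" "cut_connected V"
      proof -
        \<comment> \<open>The two copies of \<open>V'\<close> already have as many points as
          \<open>V\<close>, hence exhaust it. So \<open>V\<close> is a product, and
          \<open>V'\<close> inherits both the extremal cardinality and connectedness.\<close>
        have "card ?W = card V" using ge card_mono[OF fin sub] that(1) by simp
        then have V: "V = ?W" using card_subset_eq[OF fin sub] by simp
        have "card V' = 2 ^ Suc p'" using that(1) \<open>card ?W = card V\<close> unfolding cW p by simp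
        moreover have "cut_connected V'"
          using that(2) V cut_connected_Cons_imageD[where A = "{a, a + 1}" and V = V'] by simp
        ultimately obtain \<tau> where "cube_ok n \<tau>" "cube_dim \<tau> = Suc p'" "cube_pts \<tau> = V'"
          using IH by blast
        then show ?thesis by (subst V) (intro exI[of _ "lift True a \<tau>"], auto simp: p cube_pts_lift)
      qed
      then show ?thesis using ge card_mono[OF fin sub] by simp
    next
      case False
      \<comment> \<open>No cube extends in the first direction, so one nonempty level carries a
        cycle of the same dimension \<open>p\<close> in one ambient dimension less and already meets
        the bound.\<close>
      obtain \<sigma> where "\<sigma> \<in> S" "cube_ok (Suc n) \<sigma>" using cyc unfolding cycle_in_def by blast
      then obtain a \<rho> where "lift False a \<rho> \<in> S"
        using False by (metis (full_types) cube_ok_SucE)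
      define V' where "V' = {v. a # v \<in> V}"
      have V': "cycle_in n p V' {\<rho>. lift False a \<rho> \<in> S} (\<lambda>\<rho>. z (lift False a \<rho>))"
        using cycle_in_level[OF cyc _ \<open>lift False a \<rho> \<in> S\<close>] False p unfolding V'_def by blast
      have sub: "(#) a ` V' \<subseteq> V" by (auto simp: V'_def)
      have finV': "finite V'"
        using finite_subset[OF sub fin] by (auto dest!: finite_imageD)
      have cW: "card ((#) a ` V') = card V'" by (simp add: card_image)
      note IH = Suc.IH[OF V' finV']
      have "\<exists>\<tau>. cube_ok (Suc n) \<tau> \<and> cube_dim \<tau> = Suc p \<and> cube_pts \<tau> = V"
        if "card V = 2 ^ Suc p" "cut_connected V"
      proof -
        have "card ((#) a ` V') = card V" using IH cW card_mono[OF fin sub] that(1) by simp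
        then have V: "V = (#) a ` V'" using card_subset_eq[OF fin sub] by simp
        have "card V' = 2 ^ Suc p" using that(1) \<open>card ((#) a ` V') = card V\<close> cW by simp
        moreover have "cut_connected V'"
          using that(2) V cut_connected_Cons_imageD[where A = "{a}" and V = V'] by simp
        ultimately obtain \<tau> where "cube_ok n \<tau>" "cube_dim \<tau> = Suc p" "cube_pts \<tau> = V'"
          using IH by blast
        then show ?thesis by (subst V) (intro exI[of _ "lift False a \<tau>"], auto simp: cube_pts_lift)
      qed
      then show ?thesis using IH cW card_mono[OF fin sub] by simp
    qed
  qed
qed

section \<open>Bijections between cubes\<close>

lemma bij_betw_rank: "bij_betw (rank (snd \<sigma>)) (nondeg \<sigma>) {..<cube_dim \<sigma>}"
proof -
  have mono: "rank (snd \<sigma>) i < rank (snd \<sigma>) j" if "i \<in> nondeg \<sigma>" "i < j" for i j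
    unfolding rank_def using that by (intro psubset_card_mono) (auto simp: nondeg_def)
  have inj: "inj_on (rank (snd \<sigma>)) (nondeg \<sigma>)"
    by (rule linorder_inj_onI') (use mono in \<open>metis less_irrefl\<close>)
  have "rank (snd \<sigma>) j < cube_dim \<sigma>" if "j \<in> nondeg \<sigma>" for j
    unfolding rank_def card_nondeg[symmetric] using that
    by (intro psubset_card_mono) (auto simp: nondeg_def)
  then have "rank (snd \<sigma>) ` nondeg \<sigma> \<subseteq> {..<cube_dim \<sigma>}" by auto
  moreover have "card (rank (snd \<sigma>) ` nondeg \<sigma>) = card {..<cube_dim \<sigma>}"
    using card_image[OF inj] by (simp add: card_nondeg)
  ultimately have "rank (snd \<sigma>) ` nondeg \<sigma> = {..<cube_dim \<sigma>}" by (intro card_subset_eq) auto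
  with inj show ?thesis by (simp add: bij_betw_def)
qed

lemma rank_less: "j \<in> nondeg \<sigma> \<Longrightarrow> rank (snd \<sigma>) j < cube_dim \<sigma>"
  using bij_betw_rank[of \<sigma>] by (auto simp: bij_betw_def)

lemma rank_surj: "i < cube_dim \<sigma> \<Longrightarrow> \<exists>j\<in>nondeg \<sigma>. rank (snd \<sigma>) j = i"
  using bij_betw_imp_surj_on[OF bij_betw_rank[of \<sigma>]] by (metis imageE lessThan_iff)

section \<open>Vertices of a cube as subsets\<close>

lemma length_emb [simp]: "length (emb \<sigma> x) = length (fst \<sigma>)"
  by (simp add: emb_def)

lemma nth_emb: "j < length (fst \<sigma>) \<Longrightarrow>
    emb \<sigma> x ! j = fst \<sigma> ! j + (if snd \<sigma> ! j then x (rank (snd \<sigma>) j) else 0)"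
  by (simp add: emb_def)

lemma emb_cong:
  assumes "cube_ok n \<sigma>" "\<And>i. i < cube_dim \<sigma> \<Longrightarrow> x i = y i"
  shows "emb \<sigma> x = emb \<sigma> y"
  using assms rank_less[of _ \<sigma>]
  by (intro nth_equalityI) (auto simp: nth_emb cube_ok_def nondeg_def)

lemma emb_inject:
  assumes "cube_ok n \<sigma>" "emb \<sigma> x = emb \<sigma> y" "i < cube_dim \<sigma>"
  shows "x i = y i"
proof -
  obtain j where j: "j \<in> nondeg \<sigma>" "rank (snd \<sigma>) j = i" using rank_surj[OF assms(3)] by blast
  then have "j < length (fst \<sigma>)" using assms(1) by (simp add: nondeg_def cube_ok_def)
  then show ?thesis using arg_cong[OF assms(2), of "\<lambda>v. v ! j"] j by (simp add: nth_emb nondeg_def)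
qed

text \<open>The set \<open>A\<close> lists the normalized coordinates equal to 1, so the vertices
  become the subsets of \<open>{..<q}\<close> and an edge becomes a \<open>flip\<close>.\<close>

definition vtx :: "cube \<Rightarrow> nat set \<Rightarrow> point" where
  "vtx \<sigma> A = emb \<sigma> (\<lambda>i. if i \<in> A then 1 else 0)"

text \<open>Symmetric difference with a singleton: a step along the edge in direction
  \<open>r\<close>.\<close>

definition flip :: "nat set \<Rightarrow> nat \<Rightarrow> nat set" where
  "flip A r = {i. (i \<in> A) \<noteq> (i = r)}"

lemma emb_eq_vtx:
  assumes "cube_ok n \<sigma>" "\<And>i. x i \<in> {0, 1}"
  shows "emb \<sigma> x = vtx \<sigma> {i. i < cube_dim \<sigma> \<and> x i = 1}"
  unfolding vtx_def using assms by (intro emb_cong) auto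

lemma emb_in_cube_pts: "(\<And>i. x i \<in> {0, 1}) \<Longrightarrow> emb \<sigma> x \<in> cube_pts \<sigma>"
  by (auto simp: cube_pts_def nth_emb)

lemma bij_betw_vtx:
  assumes "cube_ok n \<sigma>"
  shows "bij_betw (vtx \<sigma>) (Pow {..<cube_dim \<sigma>}) (cube_pts \<sigma>)"
proof -
  have inj: "inj_on (vtx \<sigma>) (Pow {..<cube_dim \<sigma>})"
  proof (rule inj_onI)
    fix A B assume AB: "A \<in> Pow {..<cube_dim \<sigma>}" "B \<in> Pow {..<cube_dim \<sigma>}" "vtx \<sigma> A = vtx \<sigma> B"
    have "i \<in> A \<longleftrightarrow> i \<in> B" if "i < cube_dim \<sigma>" for i
      using emb_inject[OF assms AB(3)[unfolded vtx_def] that] by (auto split: if_splits)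
    then show "A = B" using AB(1,2) by blast
  qed
  have "vtx \<sigma> ` Pow {..<cube_dim \<sigma>} \<subseteq> cube_pts \<sigma>"
    unfolding vtx_def by (intro image_subsetI emb_in_cube_pts) simp
  moreover have "card (vtx \<sigma> ` Pow {..<cube_dim \<sigma>}) = card (cube_pts \<sigma>)"
    using card_image[OF inj] card_cube_pts[OF assms] by (simp add: card_Pow)
  ultimately have "vtx \<sigma> ` Pow {..<cube_dim \<sigma>} = cube_pts \<sigma>"
    using finite_cube_pts[OF assms] by (intro card_subset_eq) auto
  with inj show ?thesis by (simp add: bij_betw_def)
qed

lemma cube_pts_eq_emb:
  assumes "cube_ok n \<sigma>"
  shows "cube_pts \<sigma> = {emb \<sigma> x | x. \<forall>i. x i \<in> {0, 1}}"
proof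
  show "cube_pts \<sigma> \<subseteq> {emb \<sigma> x | x. \<forall>i. x i \<in> {0, 1}}"
  proof
    fix v assume "v \<in> cube_pts \<sigma>"
    then obtain A where "v = vtx \<sigma> A" using bij_betw_vtx[OF assms] by (auto simp: bij_betw_def)
    then show "v \<in> {emb \<sigma> x | x. \<forall>i. x i \<in> {0, 1}}"
      unfolding vtx_def by (intro CollectI exI[of _ "\<lambda>i. if i \<in> A then 1 else 0"]) simp
  qed
qed (auto intro: emb_in_cube_pts)

lemma c1_adj_vtx_flip:
  assumes "cube_ok n \<sigma>" "r < cube_dim \<sigma>"
  shows "c1_adj (vtx \<sigma> A) (vtx \<sigma> (flip A r))"
proof -
  obtain j where j: "j \<in> nondeg \<sigma>" "rank (snd \<sigma>) j = r" using rank_surj[OF assms(2)] by blast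
  have jl: "j < length (fst \<sigma>)" using j(1) assms(1) by (simp add: nondeg_def cube_ok_def)
  have uniq: "rank (snd \<sigma>) i \<noteq> r" if "i < length (fst \<sigma>)" "snd \<sigma> ! i" "i \<noteq> j" for i
  proof -
    have "i \<in> nondeg \<sigma>" using that assms(1) by (simp add: nondeg_def cube_ok_def)
    then show ?thesis using bij_betw_rank[of \<sigma>] j that(3) by (metis bij_betw_def inj_onD)
  qed
  show ?thesis unfolding c1_adj_def
  proof (intro conjI exI[of _ j] allI impI)
    show "\<bar>vtx \<sigma> A ! j - vtx \<sigma> (flip A r) ! j\<bar> = 1"
      using j jl by (auto simp: vtx_def nth_emb nondeg_def flip_def)
  qed (use jl uniq in \<open>auto simp: vtx_def nth_emb flip_def\<close>)
qed

lemma c1_adj_vtxD: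
  assumes "cube_ok n \<sigma>" "c1_adj (vtx \<sigma> A) (vtx \<sigma> B)" "A \<subseteq> {..<cube_dim \<sigma>}" "B \<subseteq> {..<cube_dim \<sigma>}"
  shows "\<exists>r<cube_dim \<sigma>. B = flip A r"
proof -
  obtain j where j: "j < length (fst \<sigma>)" "\<bar>vtx \<sigma> A ! j - vtx \<sigma> B ! j\<bar> = 1"
    and eq: "\<And>i. i < length (fst \<sigma>) \<Longrightarrow> i \<noteq> j \<Longrightarrow> vtx \<sigma> A ! i = vtx \<sigma> B ! i"
    using assms(2) by (auto simp: c1_adj_def vtx_def)
  define r where "r = rank (snd \<sigma>) j"
  have dj: "snd \<sigma> ! j" using j by (auto simp: vtx_def nth_emb split: if_splits)
  then have r: "r < cube_dim \<sigma>" unfolding r_def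
    using j(1) assms(1) by (intro rank_less) (simp add: nondeg_def cube_ok_def)
  have "i \<in> B \<longleftrightarrow> (i \<in> A) \<noteq> (i = r)" if "i < cube_dim \<sigma>" for i
  proof (cases "i = r")
    case True
    then show ?thesis using j dj by (auto simp: vtx_def nth_emb r_def split: if_splits)
  next
    case False
    obtain k where k: "k \<in> nondeg \<sigma>" "rank (snd \<sigma>) k = i" using rank_surj[OF \<open>i < cube_dim \<sigma>\<close>] by blast
    then have "k \<noteq> j" "k < length (fst \<sigma>)" "snd \<sigma> ! k"
      using False assms(1) by (auto simp: r_def nondeg_def cube_ok_def)
    with eq[of k] k False show ?thesis by (auto simp: vtx_def nth_emb split: if_splits)
  qed
  then have "B = flip A r" using assms(3,4) r unfolding flip_def by blast
  with r show ?thesis by blast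
qed

text \<open>Cancelling \<open>A\<close> leaves an equality of two symmetric differences of
  singletons: either both are empty or they are the same unordered pair.\<close>

lemma flip_flip_eq:
  assumes "flip (flip A r) s = flip (flip A t) u"
  shows "r = s \<and> t = u \<or> r = t \<and> s = u \<or> r = u \<and> s = t"
proof -
  have "((i = r) \<noteq> (i = s)) = ((i = t) \<noteq> (i = u))" for i
    using assms unfolding flip_def set_eq_iff mem_Collect_eq by metis
  from this[of r] this[of s] this[of t] this[of u] show ?thesis by auto
qed

text \<open>The value at a set \<open>A\<close> with two distinct elements \<open>r, s\<close> is a common neighbour of the values at
  \<open>A - {r}\<close> and \<open>A - {s}\<close>; there are only two of these, and one is the value at \<open>A - {r, s}\<close>.\<close>
lemma hypercube_automorphism:
  assumes bij: "bij_betw G (Pow {..<q}) (Pow {..<q})"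
    and adj: "\<And>A r. A \<subseteq> {..<q} \<Longrightarrow> r < q \<Longrightarrow> \<exists>s<q. G (flip A r) = flip (G A) s"
  shows "\<exists>\<pi> E. \<pi> permutes {..<q} \<and>
    (\<forall>A\<subseteq>{..<q}. G A = {i. i < q \<and> (\<pi> i \<in> A) \<noteq> (i \<in> E)})"
proof -
  \<comment> \<open>The image of the origin records which output coordinates are flipped.\<close>
  define E where "E = G {}"
  have GPow: "G A \<subseteq> {..<q}" if "A \<subseteq> {..<q}" for A using bij that by (auto simp: bij_betw_def)
  have Ginj: "A = B" if "G A = G B" "A \<subseteq> {..<q}" "B \<subseteq> {..<q}" for A B
    using bij that by (auto simp: bij_betw_def inj_on_def)
  have "\<exists>s. r < q \<longrightarrow> s < q \<and> G {r} = flip E s" for r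
    using adj[of "{}" r] by (auto simp: E_def flip_def)
  then obtain \<rho> where \<rho>: "\<And>r. r < q \<Longrightarrow> \<rho> r < q" "\<And>r. r < q \<Longrightarrow> G {r} = flip E (\<rho> r)" by metis
  have \<rho>inj: "inj_on \<rho> {..<q}"
    by (rule inj_onI) (use \<rho>(2) Ginj in \<open>metis empty_subsetI insert_subset lessThan_iff singleton_inject\<close>)
  have \<rho>bij: "bij_betw \<rho> {..<q} {..<q}"
    using \<rho>inj \<rho>(1) by (intro bij_betwI') (auto simp: inj_on_eq_iff intro: endo_inj_surj[THEN equalityD2, THEN subsetD, THEN imageE])
  have main: "i \<in> G A \<longleftrightarrow> (i \<in> \<rho> ` A) \<noteq> (i \<in> E)" if "A \<subseteq> {..<q}" for A i
    using that
  proof (induction "card A" arbitrary: A i rule: less_induct)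
    case less
    have fin: "finite A" using less.prems finite_subset by blast
    consider "A = {}" | r where "A = {r}" | r s where "r \<in> A" "s \<in> A" "r \<noteq> s" by blast
    then show ?case
    proof cases
      case 1
      then show ?thesis by (simp add: E_def)
    next
      case 2
      then show ?thesis using \<rho>(2)[of r] less.prems by (auto simp: flip_def)
    next
      case 3
      define Z where "Z = A - {r, s}"
      have sub: "Z \<subseteq> {..<q}" "A - {r} \<subseteq> {..<q}" "A - {s} \<subseteq> {..<q}" "r < q" "s < q"
        using less.prems 3 by (auto simp: Z_def)
      have smaller: "card Z < card A" "card (A - {r}) < card A" "card (A - {s}) < card A"
        unfolding Z_def by (rule psubset_card_mono[OF fin]; use 3 in blast)+
      have neq: "\<rho> r \<noteq> \<rho> s" using \<rho>inj sub(4,5) 3(3) by (auto dest: inj_onD)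
      have not: "\<rho> r \<notin> \<rho> ` Z" "\<rho> s \<notin> \<rho> ` Z"
        using \<rho>inj sub by (auto simp: Z_def dest!: inj_onD)
      have Ar: "A - {r} = insert s Z" and As: "A - {s} = insert r Z" using 3 by (auto simp: Z_def)
      have "G (A - {r}) = flip (G Z) (\<rho> s)" "G (A - {s}) = flip (G Z) (\<rho> r)"
        using less.hyps[OF smaller(1) sub(1)] less.hyps[OF smaller(2) sub(2)]
          less.hyps[OF smaller(3) sub(3)] not unfolding Ar As flip_def by auto
      moreover have "A = flip (A - {r}) r" "A = flip (A - {s}) s" using 3 by (auto simp: flip_def)
      moreover obtain u where "G (flip (A - {r}) r) = flip (G (A - {r})) u" using adj[OF sub(2,4)] by blast
      moreover obtain v where "G (flip (A - {s}) s) = flip (G (A - {s})) v" using adj[OF sub(3,5)] by blast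
      ultimately have GA: "G A = flip (flip (G Z) (\<rho> s)) u" "G A = flip (flip (G Z) (\<rho> r)) v"
        by simp_all
      \<comment> \<open>Flipping \<open>\<rho> s\<close> twice would return to the image of
        \<open>Z\<close>, contradicting injectivity. This discards the wrong one of the two common
        neighbours.\<close>
      have "u \<noteq> \<rho> s"
      proof
        assume "u = \<rho> s"
        then have "G A = G Z" unfolding GA(1) by (auto simp: flip_def)
        from Ginj[OF this less.prems sub(1)] show False using 3 by (auto simp: Z_def)
      qed
      then have "u = \<rho> r" using flip_flip_eq[of "G Z" "\<rho> s" u "\<rho> r" v] GA neq by auto
      moreover have "\<rho> ` A = insert (\<rho> r) (insert (\<rho> s) (\<rho> ` Z))" using 3 by (auto simp: Z_def)
      ultimately show ?thesis
        using less.hyps[OF smaller(1) sub(1), of i] neq not unfolding GA(1) flip_def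
        by (cases "i = \<rho> r"; cases "i = \<rho> s"; simp)
    qed
  qed
  \<comment> \<open>While \<rho> sends an input direction to the output direction it affects, the
    normal form asks which input feeds output \<open>i\<close>; hence the inverse, extended by the
    identity to a permutation of all naturals.\<close>
  define \<pi> where "\<pi> i = (if i < q then inv_into {..<q} \<rho> i else i)" for i
  have \<pi>: "\<pi> i < q" "\<rho> (\<pi> i) = i" if "i < q" for i
    using that \<rho>bij f_inv_into_f[of i \<rho> "{..<q}"] inv_into_into[of i \<rho> "{..<q}"]
    by (auto simp: \<pi>_def bij_betw_def)
  have "bij_betw \<pi> {..<q} {..<q}"
    using bij_betw_inv_into[OF \<rho>bij] by (rule bij_betw_cong[THEN iffD1, rotated]) (simp add: \<pi>_def)
  then have "\<pi> permutes {..<q}" by (rule bij_imp_permutes) (simp add: \<pi>_def)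
  moreover have "G A = {i. i < q \<and> (\<pi> i \<in> A) \<noteq> (i \<in> E)}" if A: "A \<subseteq> {..<q}" for A
  proof -
    have "i \<in> \<rho> ` A \<longleftrightarrow> \<pi> i \<in> A" if "i < q" for i
    proof
      assume "i \<in> \<rho> ` A"
      then obtain j where j: "j \<in> A" "i = \<rho> j" by blast
      then have "\<pi> i = j" using \<pi>[OF \<open>i < q\<close>] \<rho>inj A by (auto dest: inj_onD)
      then show "\<pi> i \<in> A" using j by simp
    next
      assume "\<pi> i \<in> A"
      then show "i \<in> \<rho> ` A" using \<pi>(2)[OF \<open>i < q\<close>] by (metis imageI)
    qed
    then show ?thesis using main[OF A] GPow[OF A] by blast
  qed
  ultimately show ?thesis by blast
qed

text \<open>A surjection between cubes with equally many vertices is injective, so continuity can no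
  longer collapse an edge and every edge goes to an edge. Read through \<open>vtx\<close>, the map
  is an automorphism of the hypercube graph, hence a signed coordinate permutation.\<close>

lemma cube_map_form_exists:
  assumes "cube_ok n \<sigma>" "cube_ok n \<tau>" "cube_dim \<tau> = cube_dim \<sigma>" "f ` cube_pts \<sigma> = cube_pts \<tau>"
    and cont: "\<And>x y. x \<in> cube_pts \<sigma> \<Longrightarrow> y \<in> cube_pts \<sigma> \<Longrightarrow> c1_adj x y \<Longrightarrow> c1_adj_eq (f x) (f y)"
  shows "\<exists>\<pi> e. cube_map_form f \<sigma> \<tau> \<pi> e"
proof -
  let ?q = "cube_dim \<sigma>"
  let ?P = "Pow {..<?q}"
  have "inj_on f (cube_pts \<sigma>)"
    using assms(1-4) by (intro eq_card_imp_inj_on) (simp_all add: finite_cube_pts card_cube_pts)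
  then have fbij: "bij_betw f (cube_pts \<sigma>) (cube_pts \<tau>)" using assms(4) by (simp add: bij_betw_def)
  have vs: "bij_betw (vtx \<sigma>) ?P (cube_pts \<sigma>)" using bij_betw_vtx[OF assms(1)] .
  have vt: "bij_betw (vtx \<tau>) ?P (cube_pts \<tau>)" using bij_betw_vtx[OF assms(2)] assms(3) by simp
  define G where "G = inv_into ?P (vtx \<tau>) \<circ> (f \<circ> vtx \<sigma>)"
  have Gbij: "bij_betw G ?P ?P"
    unfolding G_def by (intro bij_betw_trans[OF bij_betw_trans[OF vs fbij] bij_betw_inv_into[OF vt]])
  have vG: "vtx \<tau> (G A) = f (vtx \<sigma> A)" if "A \<subseteq> {..<?q}" for A
  proof -
    have "f (vtx \<sigma> A) \<in> cube_pts \<tau>"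
      using bij_betw_apply[OF fbij bij_betw_apply[OF vs]] that by blast
    then show ?thesis unfolding G_def using vt by (simp add: bij_betw_def f_inv_into_f)
  qed
  have GPow: "G A \<subseteq> {..<?q}" if "A \<subseteq> {..<?q}" for A using Gbij that by (auto simp: bij_betw_def)
  have "\<exists>s<?q. G (flip A r) = flip (G A) s" if A: "A \<subseteq> {..<?q}" and r: "r < ?q" for A r
  proof -
    have fl: "flip A r \<subseteq> {..<?q}" using A r by (auto simp: flip_def)
    have "A \<noteq> flip A r" by (auto simp: flip_def)
    then have "G A \<noteq> G (flip A r)" 
      using inj_onD[OF bij_betw_imp_inj_on[OF Gbij]] A fl by blast
    then have "vtx \<tau> (G A) \<noteq> vtx \<tau> (G (flip A r))"
      using inj_onD[OF bij_betw_imp_inj_on[OF vt]] GPow[OF A] GPow[OF fl] by blast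
    moreover have "c1_adj_eq (f (vtx \<sigma> A)) (f (vtx \<sigma> (flip A r)))"
      using vs A fl c1_adj_vtx_flip[OF assms(1) r] by (intro cont) (auto simp: bij_betw_def)
    ultimately have "c1_adj (vtx \<tau> (G A)) (vtx \<tau> (G (flip A r)))"
      unfolding vG[OF A] vG[OF fl] by (simp add: c1_adj_eq_def)
    from c1_adj_vtxD[OF assms(2) this] show ?thesis using GPow[OF A] GPow[OF fl] assms(3) by simp
  qed
  from hypercube_automorphism[OF Gbij this] obtain \<pi> E where \<pi>: "\<pi> permutes {..<?q}"
    and G: "\<And>A. A \<subseteq> {..<?q} \<Longrightarrow> G A = {i. i < ?q \<and> (\<pi> i \<in> A) \<noteq> (i \<in> E)}" by blast
  have "f (emb \<sigma> x) = emb \<tau> (\<lambda>i. if i \<in> E then 1 - x (\<pi> i) else x (\<pi> i))" if x: "\<forall>i. x i \<in> {0, 1}" for x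
  proof -
    let ?A = "{i. i < ?q \<and> x i = 1}"
    have A: "?A \<subseteq> {..<?q}" by auto
    have "f (emb \<sigma> x) = vtx \<tau> (G ?A)" using x by (simp only: vG[OF A] emb_eq_vtx[OF assms(1), of x])
    also have "\<dots> = emb \<tau> (\<lambda>i. if i \<in> E then 1 - x (\<pi> i) else x (\<pi> i))"
      unfolding vtx_def
    proof (rule emb_cong[OF assms(2)])
      fix i assume "i < cube_dim \<tau>"
      then have i: "i < ?q" "\<pi> i < ?q" using assms(3) permutes_in_image[OF \<pi>, of i] by auto
      have "x (\<pi> i) = 0 \<or> x (\<pi> i) = 1" using x by simp
      then show "(if i \<in> G ?A then 1 else 0) = (if i \<in> E then 1 - x (\<pi> i) else x (\<pi> i))"
        unfolding G[OF A] using i by auto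
    qed
    finally show ?thesis .
  qed
  then have "cube_map_form f \<sigma> \<tau> \<pi> (\<lambda>i. i \<in> E)" using \<pi> by (simp add: cube_map_form_def)
  then show ?thesis by blast
qed

text \<open>Makes the \<open>SOME\<close> in \<open>fbar_coeff\<close> harmless. The origin reveals
  the flips, and the indicator of coordinate \<open>\<pi> i\<close> then reveals the permutation.
  Flips at indices beyond the dimension stay undetermined, but do not enter the sign.\<close>

lemma cube_map_form_unique:
  assumes "cube_ok n \<tau>" "cube_dim \<tau> = cube_dim \<sigma>"
    and F: "cube_map_form f \<sigma> \<tau> \<pi> e" "cube_map_form f \<sigma> \<tau> \<pi>' e'"
  shows "\<pi>' = \<pi> \<and> (\<forall>i<cube_dim \<sigma>. e' i = e i)"
proof -
  have eq: "(if e i then 1 - x (\<pi> i) else x (\<pi> i)) = (if e' i then 1 - x (\<pi>' i) else x (\<pi>' i))"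
    if "\<forall>i. x i \<in> {0, 1}" "i < cube_dim \<sigma>" for x :: "nat \<Rightarrow> int" and i
  proof -
    have "emb \<tau> (\<lambda>i. if e i then 1 - x (\<pi> i) else x (\<pi> i))
        = emb \<tau> (\<lambda>i. if e' i then 1 - x (\<pi>' i) else x (\<pi>' i))"
      using F that(1) unfolding cube_map_form_def by metis
    from emb_inject[OF assms(1) this] that(2) assms(2) show ?thesis by simp
  qed
  have e: "e' i = e i" if "i < cube_dim \<sigma>" for i
    using eq[of "\<lambda>_. 0" i] that by (auto split: if_splits)
  have "\<pi>' i = \<pi> i" for i
  proof (cases "i < cube_dim \<sigma>")
    case True
    have "\<forall>j. (if j = \<pi> i then 1 else 0 :: int) \<in> {0, 1}" by simp
    from eq[OF this True] show ?thesis using e[OF True] by (auto split: if_splits)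
  next
    case False
    then show ?thesis using F unfolding cube_map_form_def by (metis lessThan_iff permutes_not_in)
  qed
  with e show ?thesis by blast
qed

lemma cube_map_form_image:
  assumes "cube_ok n \<sigma>" "cube_ok n \<tau>" "cube_map_form f \<sigma> \<tau> \<pi> e"
  shows "f ` cube_pts \<sigma> = cube_pts \<tau>"
proof -
  have f: "f (emb \<sigma> x) = emb \<tau> (\<lambda>i. if e i then 1 - x (\<pi> i) else x (\<pi> i))" if "\<forall>i. x i \<in> {0, 1}" for x
    using assms(3) that by (simp add: cube_map_form_def)
  have \<pi>: "\<pi> permutes {..<cube_dim \<sigma>}" using assms(3) by (simp add: cube_map_form_def)
  show ?thesis
  proof
    show "f ` cube_pts \<sigma> \<subseteq> cube_pts \<tau>"
    proof
      fix v assume "v \<in> f ` cube_pts \<sigma>"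
      then obtain x where x: "\<forall>i. x i \<in> {0, 1}" "v = f (emb \<sigma> x)"
        unfolding cube_pts_eq_emb[OF assms(1)] by blast
      show "v \<in> cube_pts \<tau>" unfolding x(2) f[OF x(1)]
        by (rule emb_in_cube_pts) (use x(1) in \<open>force\<close>)
    qed
    show "cube_pts \<tau> \<subseteq> f ` cube_pts \<sigma>"
    proof
      fix v assume "v \<in> cube_pts \<tau>"
      then obtain y where y: "\<forall>i. y i \<in> {0, 1}" "v = emb \<tau> y"
        unfolding cube_pts_eq_emb[OF assms(2)] by blast
      \<comment> \<open>Solves the coordinate formula for the input: coordinate \<open>j\<close> is
        read at the output position it feeds, and a flip is its own inverse.\<close>
      define x where "x j = (if e (inv_into UNIV \<pi> j) then 1 - y (inv_into UNIV \<pi> j) else y (inv_into UNIV \<pi> j))" for j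
      have x: "\<forall>i. x i \<in> {0, 1}" using y(1) unfolding x_def by force
      have "(\<lambda>i. if e i then 1 - x (\<pi> i) else x (\<pi> i)) = y"
        by (auto simp: x_def fun_eq_iff permutes_inverses[OF \<pi>])
      then have "v = f (emb \<sigma> x)" using f[OF x] y(2) by simp
      then show "v \<in> f ` cube_pts \<sigma>" using x unfolding cube_pts_eq_emb[OF assms(1)] by blast
    qed
  qed
qed

text \<open>At \<kappa> the chosen form has the same sign by uniqueness; at any other cube the
  coefficient vanishes because the image points determine the cube.\<close>

lemma fbar_coeff_of_form:
  assumes "cube_ok n \<sigma>" "cube_ok n \<kappa>" "cube_dim \<kappa> = cube_dim \<sigma>" "cube_map_form f \<sigma> \<kappa> \<pi> e"
  shows "fbar_coeff n f \<sigma> \<tau>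
    = (if \<tau> = \<kappa> then sign \<pi> * (-1) ^ card {i. i < cube_dim \<sigma> \<and> e i} else 0)"
proof (cases "\<tau> = \<kappa>")
  case True
  define p where "p = (SOME (\<pi>, e). cube_map_form f \<sigma> \<kappa> \<pi> e)"
  have "case p of (\<pi>, e) \<Rightarrow> cube_map_form f \<sigma> \<kappa> \<pi> e"
    unfolding p_def by (rule someI[of _ "(\<pi>, e)"]) (simp add: assms(4))
  then have "cube_map_form f \<sigma> \<kappa> (fst p) (snd p)" by (simp add: case_prod_beta)
  from cube_map_form_unique[OF assms(2,3,4) this]
  have p: "fst p = \<pi>" "{i. i < cube_dim \<sigma> \<and> snd p i} = {i. i < cube_dim \<sigma> \<and> e i}" by auto
  show ?thesis
    using True assms cube_map_form_image[OF assms(1,2,4)]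
    unfolding fbar_coeff_def True p_def[symmetric] by (auto simp: Let_def case_prod_beta p)
next
  case False
  have "\<not> (cube_ok n \<tau> \<and> f ` cube_pts \<sigma> = cube_pts \<tau>)"
    using cube_pts_inject[OF _ assms(2), of \<tau>] cube_map_form_image[OF assms(1,2,4)] False by metis
  then show ?thesis using False by (auto simp: fbar_coeff_def)
qed

section \<open>Faces under a signed coordinate permutation\<close>

definition face :: "bool \<Rightarrow> nat \<Rightarrow> cube \<Rightarrow> cube" where
  "face b j \<sigma> = (if b then face_B j \<sigma> else face_A j \<sigma>)"

lemma face_in_faces: "j \<in> nondeg \<sigma> \<Longrightarrow> face b j \<sigma> \<in> faces \<sigma>"
  by (simp add: face_def faces_def)

lemma rank_update:
  assumes "j < length d" "d ! j"
  shows "rank d i = rank (d[j := False]) i + (if j < i then 1 else 0)"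
proof (cases "j < i")
  case True
  have "{k. k < i \<and> d ! k} = insert j {k. k < i \<and> d[j := False] ! k}"
    using assms True by (auto simp: nth_list_update split: if_splits)
  moreover have "j \<notin> {k. k < i \<and> d[j := False] ! k}" using assms by simp
  ultimately show ?thesis using True by (simp add: rank_def)
next
  case False
  have "{k. k < i \<and> d ! k} = {k. k < i \<and> d[j := False] ! k}"
    using False by (auto simp: nth_list_update)
  then show ?thesis using False by (simp add: rank_def)
qed

lemma emb_face:
  assumes "cube_ok n \<sigma>" "j \<in> nondeg \<sigma>"
  shows "emb (face b j \<sigma>) x = emb \<sigma> (insert_dom x (rank (snd \<sigma>) j) (if b then 1 else 0))"
proof (rule nth_equalityI)
  show "length (emb (face b j \<sigma>) x) = length (emb \<sigma> (insert_dom x (rank (snd \<sigma>) j) (if b then 1 else 0)))"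
    by (simp add: face_def face_A_def face_B_def)
  fix i assume "i < length (emb (face b j \<sigma>) x)"
  then have i: "i < length (fst \<sigma>)" "i < length (fst (face b j \<sigma>))" "i < length (snd \<sigma>)"
    using assms(1) by (simp_all add: face_def face_A_def face_B_def cube_ok_def split: if_splits)
  have j: "j < length (snd \<sigma>)" "snd \<sigma> ! j" "j < length (fst \<sigma>)"
    using assms by (simp_all add: nondeg_def cube_ok_def)
  have snd: "snd (face b j \<sigma>) = (snd \<sigma>)[j := False]" by (simp add: face_def face_A_def face_B_def)
  show "emb (face b j \<sigma>) x ! i = emb \<sigma> (insert_dom x (rank (snd \<sigma>) j) (if b then 1 else 0)) ! i"
  proof (cases "i = j")
    case True
    then show ?thesis using i j
      by (simp add: nth_emb snd insert_dom_def) (simp add: face_def face_A_def face_B_def)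
  next
    case False
    have fst: "fst (face b j \<sigma>) ! i = fst \<sigma> ! i" "snd (face b j \<sigma>) ! i = snd \<sigma> ! i"
      using False by (simp_all add: face_def face_A_def face_B_def)
    show ?thesis
    proof (cases "snd \<sigma> ! i")
      case d: True
      then have inond: "i \<in> nondeg \<sigma>" using i by (simp add: nondeg_def)
      have "rank (snd \<sigma>) i \<noteq> rank (snd \<sigma>) j"
        using bij_betw_rank[of \<sigma>] inond assms(2) False by (auto simp: bij_betw_def dest: inj_onD)
      moreover have "i < j \<Longrightarrow> rank (snd \<sigma>) i \<le> rank (snd \<sigma>) j" "j < i \<Longrightarrow> rank (snd \<sigma>) j \<le> rank (snd \<sigma>) i"
        by (auto simp: rank_def intro!: card_mono)
      ultimately show ?thesis
        using False i d rank_update[OF j(1,2), of i] fst snd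
        by (cases "i < j") (auto simp: nth_emb insert_dom_def)
    next
      case False
      then show ?thesis using i fst by (simp add: nth_emb)
    qed
  qed
qed

lemma insert_dom_insert_index [simp]: "insert_dom x r v (insert_index r i) = x i"
  by (auto simp: insert_dom_def insert_index_def)

lemma insert_dom_same [simp]: "insert_dom x (r :: nat) v r = v"
  unfolding insert_dom_def by simp

text \<open>Input coordinate \<open>\<pi> r\<close> feeds output coordinate \<open>r\<close> and
  nothing else. Freezing it at \<open>b\<close> freezes the output at \<open>b\<close>, or at the
  opposite value if \<open>e r\<close>; the other coordinates keep their rule, renumbered after
  deletion of \<open>r\<close> and \<open>\<pi> r\<close>.\<close>

lemma cube_map_form_face:
  assumes "cube_ok n \<sigma>" "cube_ok n \<kappa>" "cube_dim \<sigma> = Suc p" "cube_map_form f \<sigma> \<kappa> \<pi> e"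
    and j: "j \<in> nondeg \<sigma>" and k: "k \<in> nondeg \<kappa>" and dim: "cube_dim \<kappa> = cube_dim \<sigma>"
    and r: "r = rank (snd \<kappa>) k" "rank (snd \<sigma>) j = \<pi> r"
  shows "cube_map_form f (face b j \<sigma>) (face (b \<noteq> e r) k \<kappa>) (permutation_delete \<pi> r)
    (\<lambda>i. e (insert_index r i))"
  unfolding cube_map_form_def
proof (intro conjI allI impI)
  have \<pi>: "\<pi> permutes {0..<Suc p}" using assms(3,4) by (simp add: cube_map_form_def atLeast0LessThan)
  have "r < Suc p" using rank_less[OF k] r dim assms(3) by simp
  moreover have "cube_dim (face b j \<sigma>) = p"
    using faces_props(2)[OF face_in_faces[OF j, of b]] assms(3) by simp
  ultimately show "permutation_delete \<pi> r permutes {..<cube_dim (face b j \<sigma>)}"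
    using permutation_delete_permutes[OF \<pi>] by (simp add: atLeast0LessThan)
  fix x :: "nat \<Rightarrow> int" assume x: "\<forall>i. x i \<in> {0, 1}"
  define X where "X = insert_dom x (\<pi> r) (if b then 1 else 0)"
  have X: "\<forall>i. X i \<in> {0, 1}" using x by (auto simp: X_def insert_dom_def)
  define Y where "Y i = (if e (insert_index r i) then 1 - x (permutation_delete \<pi> r i)
      else x (permutation_delete \<pi> r i))" for i
  have "f (emb (face b j \<sigma>) x) = f (emb \<sigma> X)" unfolding X_def emb_face[OF assms(1) j] r(2) ..
  also have "\<dots> = emb \<kappa> (\<lambda>i. if e i then 1 - X (\<pi> i) else X (\<pi> i))"
    using assms(4) X by (simp add: cube_map_form_def)
  also have "(\<lambda>i. if e i then 1 - X (\<pi> i) else X (\<pi> i)) = insert_dom Y r (if b \<noteq> e r then 1 else 0)"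
  proof
    fix i
    show "(if e i then 1 - X (\<pi> i) else X (\<pi> i)) = insert_dom Y r (if b \<noteq> e r then 1 else 0) i"
    proof (cases "i = r")
      case True
      then show ?thesis by (simp add: X_def)
    next
      case False
      then obtain i' where i': "i = insert_index r i'" using insert_delete_index by metis
      have "\<pi> i \<noteq> \<pi> r" using permutes_inj[OF \<pi>] False by (simp add: inj_eq)
      then have "insert_index (\<pi> r) (permutation_delete \<pi> r i') = \<pi> i"
        unfolding permutation_delete_def delete_ran_def delete_dom_def i'[symmetric]
        by (rule insert_delete_index)
      then have "X (\<pi> i) = x (permutation_delete \<pi> r i')"
        unfolding X_def by (metis insert_dom_insert_index)
      then show ?thesis by (simp add: i' Y_def)
    qed
  qed
  also have "emb \<kappa> \<dots> = emb (face (b \<noteq> e r) k \<kappa>) Y"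
    unfolding emb_face[OF assms(2) k] r(1) ..
  finally show "f (emb (face b j \<sigma>) x) = emb (face (b \<noteq> e r) k \<kappa>)
      (\<lambda>i. if e (insert_index r i) then 1 - x (permutation_delete \<pi> r i)
        else x (permutation_delete \<pi> r i))"
    unfolding Y_def .
qed

text \<open>The cofactor sign of Laplace expansion, for the permutation matrix with row
  \<open>r\<close> and column \<open>\<pi> r\<close> removed.\<close>

lemma sign_permutation_delete:
  assumes "\<pi> permutes {..<Suc p}" "r < Suc p"
  shows "sign (permutation_delete \<pi> r) = (-1) ^ (r + \<pi> r) * sign \<pi>"
proof -
  have \<pi>: "\<pi> permutes {0..<Suc p}" using assms(1) by (simp add: atLeast0LessThan)
  have "\<pi> r < Suc p" using permutes_in_image[OF assms(1), of r] assms(2) by simp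
  from signof_permutation_insert[OF permutation_delete_permutes[OF \<pi> assms(2)] assms(2) this, where 'a = int]
  have "sign \<pi> = (-1) ^ (r + \<pi> r) * sign (permutation_delete \<pi> r)"
    unfolding permutation_insert_delete[OF \<pi> assms(2)] by simp
  moreover have "(-1 :: int) ^ (r + \<pi> r) * (-1) ^ (r + \<pi> r) = 1"
    by (simp flip: power_mult_distrib)
  ultimately show ?thesis by (simp flip: mult.assoc)
qed

lemma card_insert_index:
  assumes "r < Suc p"
  shows "card {i. i < Suc p \<and> e i} = (if e r then 1 else 0) + card {i. i < p \<and> e (insert_index r i)}"
proof -
  let ?I = "insert_index r ` {i. i < p \<and> e (insert_index r i)}"
  have "{i. i < Suc p \<and> e i} = (if e r then {r} else {}) \<union> ?I"
  proof -
    have "i \<in> ?I" if "i < Suc p" "e i" "i \<noteq> r" for i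
      using that assms insert_delete_index[of i r]
      by (intro image_eqI[of _ _ "delete_index r i"]) (auto simp: delete_index_def split: if_splits)
    moreover have "insert_index r i < Suc p" if "i < p" for i using that by (simp add: insert_index_def)
    ultimately show ?thesis using assms by auto
  qed
  moreover have "card ?I = card {i. i < p \<and> e (insert_index r i)}"
    by (rule card_image[OF insert_index_inj_on])
  moreover have "r \<notin> ?I" by (auto dest: sym)
  ultimately show ?thesis by simp
qed

text \<open>Direction \<open>k\<close> of \<kappa>, of rank \<open>r\<close>, is matched with the
  direction of \<sigma> of rank \<open>\<pi> r\<close>. The boundary sign of \<sigma> times the
  cofactor sign is the boundary sign of \<kappa>. If \<open>e r\<close> holds, the lower and upper
  faces are exchanged, but the faces also have one flip fewer, and the two signs cancel.\<close>

lemma fbar_bdsum_of_form: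
  assumes ok: "cube_ok n \<sigma>" "cube_ok n \<kappa>" and dim: "cube_dim \<kappa> = cube_dim \<sigma>"
    and form: "cube_map_form f \<sigma> \<kappa> \<pi> e"
  shows "bdsum \<sigma> (\<lambda>\<rho>. fbar_coeff n f \<rho> \<tau>) = fbar_coeff n f \<sigma> \<kappa> * bd_coeff \<kappa> \<tau>"
proof -
  let ?q = "cube_dim \<sigma>"
  let ?s = "sign \<pi> * (-1) ^ card {i. i < ?q \<and> e i} :: int"
  let ?R = "rank (snd \<kappa>)"
  have \<pi>: "\<pi> permutes {..<?q}" using form by (simp add: cube_map_form_def)
  \<comment> \<open>Translates a direction of \<kappa> to its rank, to the rank of the input feeding
    it, and back to a direction of \<sigma>.\<close>
  define J where "J = inv_into (nondeg \<sigma>) (rank (snd \<sigma>)) \<circ> (\<pi> \<circ> ?R)"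
  have "bij_betw ?R (nondeg \<kappa>) {..<?q}" using bij_betw_rank[of \<kappa>] dim by simp
  then have Jbij: "bij_betw J (nondeg \<kappa>) (nondeg \<sigma>)"
    unfolding J_def
    by (intro bij_betw_trans[OF bij_betw_trans[OF _ permutes_imp_bij[OF \<pi>]] bij_betw_inv_into[OF bij_betw_rank]])
  have summand: "(-1) ^ Suc (rank (snd \<sigma>) (J k)) *
        (fbar_coeff n f (face_A (J k) \<sigma>) \<tau> - fbar_coeff n f (face_B (J k) \<sigma>) \<tau>)
      = ?s * ((-1) ^ Suc (?R k) *
        ((if \<tau> = face_A k \<kappa> then 1 else 0) - (if \<tau> = face_B k \<kappa> then 1 else 0)))"
    if k: "k \<in> nondeg \<kappa>" for k
  proof -
    define r where "r = ?R k"
    have r: "r < ?q" using rank_less[OF k] dim by (simp add: r_def)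
    then obtain p where p: "?q = Suc p" by (cases ?q) auto
    have J: "J k \<in> nondeg \<sigma>" using Jbij k by (auto simp: bij_betw_def)
    have Jr: "rank (snd \<sigma>) (J k) = \<pi> r"
      using permutes_in_image[OF \<pi>, of r] r bij_betw_rank[of \<sigma>]
      by (auto simp: J_def r_def bij_betw_def f_inv_into_f)
    have fb: "fbar_coeff n f (face b (J k) \<sigma>) \<tau>
      = (if \<tau> = face (b \<noteq> e r) k \<kappa> then (-1) ^ (r + \<pi> r) * (if e r then -1 else 1) * ?s else 0)" for b
    proof -
      have F: "face b (J k) \<sigma> \<in> faces \<sigma>" "face (b \<noteq> e r) k \<kappa> \<in> faces \<kappa>"
        using face_in_faces J k by blast+
      have d: "cube_dim (face b (J k) \<sigma>) = p" "cube_dim (face (b \<noteq> e r) k \<kappa>) = p"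
        using faces_props(2)[OF F(1)] faces_props(2)[OF F(2)] p dim by auto
      have "fbar_coeff n f (face b (J k) \<sigma>) \<tau> = (if \<tau> = face (b \<noteq> e r) k \<kappa>
        then sign (permutation_delete \<pi> r) * (-1) ^ card {i. i < p \<and> e (insert_index r i)} else 0)"
        using fbar_coeff_of_form[OF faces_props(1)[OF F(1) ok(1)] faces_props(1)[OF F(2) ok(2)] _
          cube_map_form_face[OF ok p form J k dim r_def Jr, of b], of \<tau>] d by simp
      moreover have "sign (permutation_delete \<pi> r) * (-1) ^ card {i. i < p \<and> e (insert_index r i)}
          = (-1) ^ (r + \<pi> r) * (if e r then -1 else 1) * ?s"
        using sign_permutation_delete[of \<pi> p r] \<pi> r p card_insert_index[of r p e] by simp
      ultimately show ?thesis by simp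
    qed
    have pow: "(-1 :: int) ^ Suc (\<pi> r) * (-1) ^ (r + \<pi> r) = (-1) ^ Suc r"
      by (simp add: power_add mult.left_commute[of "(-1) ^ \<pi> r"] flip: power_mult_distrib)
    have "(-1) ^ Suc (rank (snd \<sigma>) (J k)) *
        (fbar_coeff n f (face_A (J k) \<sigma>) \<tau> - fbar_coeff n f (face_B (J k) \<sigma>) \<tau>)
      = ((-1) ^ Suc (\<pi> r) * (-1) ^ (r + \<pi> r)) * ?s * (if e r then -1 else 1) *
        ((if \<tau> = face (e r) k \<kappa> then 1 else 0) - (if \<tau> = face (\<not> e r) k \<kappa> then 1 else 0))"
      using fb[of False] fb[of True] by (simp add: face_def[of _ "J k"] Jr)
    also have "\<dots> = (-1) ^ Suc r * ?s *
        ((if \<tau> = face_A k \<kappa> then 1 else 0) - (if \<tau> = face_B k \<kappa> then 1 else 0))"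
      unfolding pow by (cases "e r") (simp_all add: face_def)
    finally show ?thesis by (simp only: r_def ac_simps)
  qed
  have "bdsum \<sigma> (\<lambda>\<rho>. fbar_coeff n f \<rho> \<tau>) = (\<Sum>k\<in>nondeg \<kappa>. (-1) ^ Suc (rank (snd \<sigma>) (J k)) *
        (fbar_coeff n f (face_A (J k) \<sigma>) \<tau> - fbar_coeff n f (face_B (J k) \<sigma>) \<tau>))"
    unfolding bdsum_def by (rule sum.reindex_bij_betw[OF Jbij, symmetric])
  also have "\<dots> = ?s * bd_coeff \<kappa> \<tau>"
    unfolding bd_coeff_eq_bdsum bdsum_def sum_distrib_left by (intro sum.cong refl summand)
  also have "?s = fbar_coeff n f \<sigma> \<kappa>"
    using fbar_coeff_of_form[OF ok dim form, of \<kappa>] by simp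
  finally show ?thesis .
qed

section \<open>The chain map\<close>

lemma finite_cubes:
  assumes "finite X"
  shows "finite (cubes X n q)"
proof -
  have "cubes X n q \<subseteq> X \<times> {d. set d \<subseteq> UNIV \<and> length d = n}"
  proof
    fix \<sigma> assume "\<sigma> \<in> cubes X n q"
    then have "fst \<sigma> \<in> X" "length (snd \<sigma>) = n"
      using fst_in_cube_pts[of \<sigma>] by (auto simp: cubes_def cube_ok_def)
    then show "\<sigma> \<in> X \<times> {d. set d \<subseteq> UNIV \<and> length d = n}" by (simp add: mem_Times_iff)
  qed
  moreover have "finite (X \<times> {d :: bool list. set d \<subseteq> UNIV \<and> length d = n})"
    using assms finite_lists_length_eq[of "UNIV :: bool set" n] by simp
  ultimately show ?thesis by (rule finite_subset)
qed

lemma faces_in_cubes: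
  assumes "\<sigma> \<in> cubes X n (Suc q)" "\<rho> \<in> faces \<sigma>"
  shows "\<rho> \<in> cubes X n q"
  using assms faces_props[OF assms(2)] by (auto simp: cubes_def)

lemma bd_coeff_nonzero_face:
  assumes "bd_coeff \<sigma> \<tau> \<noteq> 0"
  shows "\<tau> \<in> faces \<sigma>"
proof (rule ccontr)
  assume "\<tau> \<notin> faces \<sigma>"
  then have "bdsum \<sigma> (\<lambda>\<rho>. if \<tau> = \<rho> then 1 else 0) = bdsum \<sigma> (\<lambda>_. 0)"
    by (intro bdsum_cong) auto
  then show False using assms by (simp add: bd_coeff_eq_bdsum)
qed

lemma fbar_coeff_nonzero:
  assumes "fbar_coeff n f \<sigma> \<tau> \<noteq> 0"
  shows "cube_ok n \<tau>" "cube_dim \<tau> = cube_dim \<sigma>" "f ` cube_pts \<sigma> = cube_pts \<tau>"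
  using assms by (auto simp: fbar_coeff_def split: if_splits)

text \<open>A cut of the image pulls back to a cut of \<open>V\<close>. The images of a crossing
  edge lie on different sides, so they are distinct, and continuity leaves only adjacency.\<close>

lemma cut_connected_image:
  assumes "cut_connected V" "\<And>x y. x \<in> V \<Longrightarrow> y \<in> V \<Longrightarrow> c1_adj x y \<Longrightarrow> c1_adj_eq (f x) (f y)"
  shows "cut_connected (f ` V)"
  unfolding cut_connected_def
proof (intro allI impI)
  fix U assume U: "U \<subseteq> f ` V" "U \<noteq> {}" "U \<noteq> f ` V"
  let ?W = "{x \<in> V. f x \<in> U}"
  have "?W \<subseteq> V" "?W \<noteq> {}" "?W \<noteq> V" using U by auto
  then have "\<exists>x\<in>?W. \<exists>y\<in>V - ?W. c1_adj x y"
    by (rule assms(1)[unfolded cut_connected_def, rule_format])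
  then obtain x y where "x \<in> ?W" "y \<in> V - ?W" "c1_adj x y" by blast
  moreover from this have "f x \<noteq> f y" by auto
  ultimately have "c1_adj (f x) (f y)" "f x \<in> U" "f y \<in> f ` V - U"
    using assms(2)[of x y] by (auto simp: c1_adj_eq_def)
  then show "\<exists>u\<in>U. \<exists>v\<in>f ` V - U. c1_adj u v" by blast
qed

locale digital_map =
  fixes X :: "point set" and n :: nat and f :: "point \<Rightarrow> point"
  assumes finX: "finite X" and lenX: "\<And>x. x \<in> X \<Longrightarrow> length x = n" and cont: "digitally_continuous X f"
begin

lemma cubeD:
  assumes "\<sigma> \<in> cubes X n q"
  shows "cube_ok n \<sigma>" "cube_dim \<sigma> = q" "cube_pts \<sigma> \<subseteq> X"
  using assms by (auto simp: cubes_def)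

lemma continuous_on_cube:
  assumes "\<sigma> \<in> cubes X n q" "x \<in> cube_pts \<sigma>" "y \<in> cube_pts \<sigma>" "c1_adj x y"
  shows "c1_adj_eq (f x) (f y)"
  using cont assms cubeD(3)[OF assms(1)] unfolding digitally_continuous_def by blast

lemma image_in_X: "\<sigma> \<in> cubes X n q \<Longrightarrow> f ` cube_pts \<sigma> \<subseteq> X"
  using cont cubeD(3)[of \<sigma> q] unfolding digitally_continuous_def by blast

lemma fbar_coeff_in_cubes:
  assumes "\<sigma> \<in> cubes X n q" "fbar_coeff n f \<sigma> \<tau> \<noteq> 0"
  shows "\<tau> \<in> cubes X n q"
  using fbar_coeff_nonzero[OF assms(2)] cubeD[OF assms(1)] image_in_X[OF assms(1)]
  by (simp add: cubes_def)

text \<open>The augmentation is preserved: a point goes to a point with coefficient 1, the only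
  permutation of no coordinates being the identity. This makes the image of the boundary of an edge
  a reduced cycle.\<close>

lemma sum_fbar_coeff_point:
  assumes "\<sigma> \<in> cubes X n 0"
  shows "(\<Sum>\<tau>\<in>cubes X n 0. fbar_coeff n f \<sigma> \<tau>) = 1"
proof -
  note \<sigma> = cubeD[OF assms]
  have "card (cube_pts \<sigma>) = 1" using card_cube_pts[OF \<sigma>(1)] \<sigma>(2) by simp
  then have pts: "cube_pts \<sigma> = {fst \<sigma>}"
    using fst_in_cube_pts[of \<sigma>] by (metis card_1_singletonE singletonD)
  define \<kappa> :: cube where "\<kappa> = (f (fst \<sigma>), replicate n False)"
  have fX: "f (fst \<sigma>) \<in> X" using image_in_X[OF assms] by (simp add: pts)
  then have \<kappa>: "cube_ok n \<kappa>" "cube_dim \<kappa> = 0"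
    using lenX by (simp_all add: \<kappa>_def cube_ok_def cube_dim_def)
  have "card (cube_pts \<kappa>) = 1" using card_cube_pts[OF \<kappa>(1)] \<kappa>(2) by simp
  then have pts\<kappa>: "cube_pts \<kappa> = {f (fst \<sigma>)}"
    using fst_in_cube_pts[of \<kappa>] by (metis \<kappa>_def card_1_singletonE fst_conv singletonD)
  have mem: "\<kappa> \<in> cubes X n 0" using \<kappa> pts\<kappa> fX by (simp add: cubes_def)
  have "\<exists>\<pi> e. cube_map_form f \<sigma> \<kappa> \<pi> e"
    using continuous_on_cube[OF assms]
    by (intro cube_map_form_exists[OF \<sigma>(1) \<kappa>(1)]) (simp_all add: \<kappa>(2) \<sigma>(2) pts pts\<kappa>)
  then obtain \<pi> e where form: "cube_map_form f \<sigma> \<kappa> \<pi> e" by blast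
  then have "\<pi> = id" using \<sigma>(2) by (simp add: cube_map_form_def)
  then have "fbar_coeff n f \<sigma> \<tau> = (if \<tau> = \<kappa> then 1 else 0)" for \<tau>
    using fbar_coeff_of_form[OF \<sigma>(1) \<kappa>(1) _ form, of \<tau>] \<kappa>(2) \<sigma>(2) by simp
  then show ?thesis using mem finite_cubes[OF finX, of n 0] by simp
qed

text \<open>If \<open>f \<sigma>\<close> is not a \<open>q\<close>-cube, the image of \<open>\<partial>\<sigma>\<close> is a cycle whose vertices lie in the at most
  \<open>2 ^ q\<close> points of \<open>f \<sigma>\<close>, so it vanishes by the vertex count for cycles.\<close>
lemma fbar_coeff_chain_map:
  assumes "\<sigma> \<in> cubes X n q"
  shows "bdsum \<sigma> (\<lambda>\<rho>. fbar_coeff n f \<rho> \<tau>) = (\<Sum>\<kappa>\<in>cubes X n q. fbar_coeff n f \<sigma> \<kappa> * bd_coeff \<kappa> \<tau>)"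
  using assms
proof (induction q arbitrary: \<sigma> \<tau>)
  case 0
  then have "nondeg \<sigma> = {}" using cubeD(2)[OF 0] card_nondeg[of \<sigma>] by simp
  moreover have "bd_coeff \<kappa> \<tau> = 0" if "\<kappa> \<in> cubes X n 0" for \<kappa>
  proof -
    have "nondeg \<kappa> = {}" using cubeD(2)[OF that] card_nondeg[of \<kappa>] by simp
    then show ?thesis by (simp add: bd_coeff_eq_bdsum bdsum_def)
  qed
  ultimately show ?case by (simp add: bdsum_def)
next
  case (Suc p)
  note \<sigma> = cubeD[OF Suc.prems]
  show ?case
  proof (cases "\<exists>\<kappa>. cube_ok n \<kappa> \<and> cube_dim \<kappa> = Suc p \<and> f ` cube_pts \<sigma> = cube_pts \<kappa>")
    case True
    then obtain \<kappa> where \<kappa>: "cube_ok n \<kappa>" "cube_dim \<kappa> = Suc p" "f ` cube_pts \<sigma> = cube_pts \<kappa>" by blast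
    have dim: "cube_dim \<kappa> = cube_dim \<sigma>" using \<kappa>(2) \<sigma>(2) by simp
    have "\<exists>\<pi> e. cube_map_form f \<sigma> \<kappa> \<pi> e"
      using continuous_on_cube[OF Suc.prems] by (rule cube_map_form_exists[OF \<sigma>(1) \<kappa>(1) dim \<kappa>(3)])
    then obtain \<pi> e where form: "cube_map_form f \<sigma> \<kappa> \<pi> e" by blast
    have mem: "\<kappa> \<in> cubes X n (Suc p)" using \<kappa> image_in_X[OF Suc.prems] by (simp add: cubes_def)
    have "fbar_coeff n f \<sigma> \<kappa>' = (if \<kappa>' = \<kappa> then fbar_coeff n f \<sigma> \<kappa> else 0)" for \<kappa>'
      using fbar_coeff_of_form[OF \<sigma>(1) \<kappa>(1) dim form] by simp
    then have "(\<Sum>\<kappa>'\<in>cubes X n (Suc p). fbar_coeff n f \<sigma> \<kappa>' * bd_coeff \<kappa>' \<tau>)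
        = (\<Sum>\<kappa>'\<in>cubes X n (Suc p). if \<kappa>' = \<kappa> then fbar_coeff n f \<sigma> \<kappa> * bd_coeff \<kappa> \<tau> else 0)"
      by (intro sum.cong refl) (metis mult_zero_left)
    also have "\<dots> = fbar_coeff n f \<sigma> \<kappa> * bd_coeff \<kappa> \<tau>"
      using mem finite_cubes[OF finX, of n "Suc p"] by simp
    finally show ?thesis using fbar_bdsum_of_form[OF \<sigma>(1) \<kappa>(1) dim form, of \<tau>] by simp
  next
    case False
    \<comment> \<open>The coefficients of the image of \<partial>\<sigma>. In this case \<sigma>
      itself is sent to 0, so the claim is that \<open>z\<close> vanishes.\<close>
    define z where "z \<upsilon> = bdsum \<sigma> (\<lambda>\<rho>. fbar_coeff n f \<rho> \<upsilon>)" for \<upsilon>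
    let ?C = "cubes X n p" and ?V = "f ` cube_pts \<sigma>"
    have finC: "finite ?C" using finite_cubes[OF finX] .
    have supp: "\<exists>\<rho>\<in>faces \<sigma>. fbar_coeff n f \<rho> \<upsilon> \<noteq> 0" if "z \<upsilon> \<noteq> 0" for \<upsilon>
    proof (rule ccontr)
      assume "\<not> ?thesis"
      then have "z \<upsilon> = bdsum \<sigma> (\<lambda>_. 0)" unfolding z_def by (intro bdsum_cong) blast
      then show False using that by simp
    qed
    have S: "\<upsilon> \<in> ?C" "cube_pts \<upsilon> \<subseteq> ?V" if nz: "z \<upsilon> \<noteq> 0" for \<upsilon>
    proof -
      obtain \<rho> where \<rho>: "\<rho> \<in> faces \<sigma>" "fbar_coeff n f \<rho> \<upsilon> \<noteq> 0" using supp[OF nz] by blast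
      show "\<upsilon> \<in> ?C" using fbar_coeff_in_cubes[OF faces_in_cubes[OF Suc.prems \<rho>(1)] \<rho>(2)] .
      show "cube_pts \<upsilon> \<subseteq> ?V" using fbar_coeff_nonzero(3)[OF \<rho>(2)] faces_props(3)[OF \<rho>(1)] by blast
    qed
    have restrict: "(\<Sum>\<upsilon>\<in>{\<upsilon>. z \<upsilon> \<noteq> 0}. z \<upsilon> * h \<upsilon>) = (\<Sum>\<upsilon>\<in>?C. z \<upsilon> * h \<upsilon>)" for h
      using S(1) finC by (intro sum.mono_neutral_left) auto
    have swap: "(\<Sum>\<upsilon>\<in>?C. z \<upsilon> * h \<upsilon>) = bdsum \<sigma> (\<lambda>\<rho>. \<Sum>\<upsilon>\<in>?C. fbar_coeff n f \<rho> \<upsilon> * h \<upsilon>)" for h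
      unfolding z_def by (simp add: bdsum_sum bdsum_mult)
    \<comment> \<open>The induction hypothesis for the faces moves \<partial> past the map, turning
      the boundary of \<open>z\<close> into the image of \<partial>\<partial>\<sigma>.\<close>
    have cyc: "(\<Sum>\<upsilon>\<in>{\<upsilon>. z \<upsilon> \<noteq> 0}. z \<upsilon> * bd_coeff \<upsilon> \<omega>) = 0" for \<omega>
    proof -
      have "bdsum \<sigma> (\<lambda>\<rho>. \<Sum>\<upsilon>\<in>?C. fbar_coeff n f \<rho> \<upsilon> * bd_coeff \<upsilon> \<omega>)
          = bdsum \<sigma> (\<lambda>\<rho>. bdsum \<rho> (\<lambda>\<rho>'. fbar_coeff n f \<rho>' \<omega>))"
        by (rule bdsum_cong) (simp add: Suc.IH[OF faces_in_cubes[OF Suc.prems]])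
      then show ?thesis unfolding restrict swap by (simp add: bdsum_bdsum[OF \<sigma>(1)])
    qed
    have aug: "(\<Sum>\<upsilon>\<in>{\<upsilon>. z \<upsilon> \<noteq> 0}. z \<upsilon>) = 0" if "p = 0"
    proof -
      have "bdsum \<sigma> (\<lambda>\<rho>. \<Sum>\<upsilon>\<in>?C. fbar_coeff n f \<rho> \<upsilon> * 1) = bdsum \<sigma> (\<lambda>_. 1)"
        using faces_in_cubes[OF Suc.prems] sum_fbar_coeff_point unfolding that
        by (intro bdsum_cong) simp
      then show ?thesis using restrict[of "\<lambda>_. 1"] swap[of "\<lambda>_. 1"] by simp
    qed
    have "z \<tau> = 0"
    proof (rule ccontr)
      assume "z \<tau> \<noteq> 0"
      then have cycle: "cycle_in n p ?V {\<upsilon>. z \<upsilon> \<noteq> 0} z"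
        unfolding cycle_in_def using cyc aug S cubeD finite_subset[OF _ finC, of "{\<upsilon>. z \<upsilon> \<noteq> 0}"]
        by blast
      have finV: "finite ?V" using finite_cube_pts[OF \<sigma>(1)] by simp
      have "card ?V \<le> 2 ^ Suc p"
        using card_image_le[OF finite_cube_pts[OF \<sigma>(1)], of f] card_cube_pts[OF \<sigma>(1)] \<sigma>(2) by simp
      moreover have "cut_connected ?V"
        using cut_connected_image[OF cut_connected_cube[OF \<sigma>(1)]] continuous_on_cube[OF Suc.prems] by blast
      ultimately show False using cycle_vertices[OF cycle finV] False by (metis le_antisym)
    qed
    moreover have "fbar_coeff n f \<sigma> \<kappa> = 0" for \<kappa>
      using fbar_coeff_nonzero[of n f \<sigma> \<kappa>] False \<sigma>(2) by metis
    ultimately show ?thesis by (simp add: z_def)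
  qed
qed

end

section \<open>The trace formula\<close>

text \<open>Common form of \<open>bd\<close> and \<open>fbar\<close>: the matrix acts from the right
  on a row of coefficients, so composition is the matrix product in order of application.\<close>

definition matop :: "'a set \<Rightarrow> ('a \<Rightarrow> 'b \<Rightarrow> int) \<Rightarrow> ('a \<Rightarrow> rat) \<Rightarrow> 'b \<Rightarrow> rat" where
  "matop S M c = (\<lambda>\<tau>. \<Sum>\<sigma>\<in>S. c \<sigma> * of_int (M \<sigma> \<tau>))"

lemma bd_eq_matop: "bd X n q = matop (cubes X n q) bd_coeff"
  by (simp add: fun_eq_iff bd_def matop_def)

lemma fbar_eq_matop: "fbar X n q f = matop (cubes X n q) (fbar_coeff n f)"
  by (simp add: fun_eq_iff fbar_def matop_def)

lemma lin_map_matop: "lin_map (matop S M)"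
  unfolding lin_map_def matop_def
  by (simp add: sum_distrib_left sum.distrib distrib_right mult.assoc)

lemma matop_matop: "matop T N (matop S M c) = matop S (\<lambda>\<sigma> \<tau>. \<Sum>\<rho>\<in>T. M \<sigma> \<rho> * N \<rho> \<tau>) c"
proof
  fix \<tau>
  have "(\<Sum>\<rho>\<in>T. (\<Sum>\<sigma>\<in>S. c \<sigma> * of_int (M \<sigma> \<rho>)) * of_int (N \<rho> \<tau>))
      = (\<Sum>\<rho>\<in>T. \<Sum>\<sigma>\<in>S. c \<sigma> * (of_int (M \<sigma> \<rho>) * of_int (N \<rho> \<tau>)))"
    by (simp add: sum_distrib_right mult.assoc)
  also have "\<dots> = (\<Sum>\<sigma>\<in>S. \<Sum>\<rho>\<in>T. c \<sigma> * (of_int (M \<sigma> \<rho>) * of_int (N \<rho> \<tau>)))" by (rule sum.swap)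
  finally show "matop T N (matop S M c) \<tau> = matop S (\<lambda>\<sigma> \<tau>. \<Sum>\<rho>\<in>T. M \<sigma> \<rho> * N \<rho> \<tau>) c \<tau>"
    by (simp add: matop_def sum_distrib_left)
qed

lemma matop_cong:
  "(\<And>\<sigma> \<tau>. \<sigma> \<in> S \<Longrightarrow> M \<sigma> \<tau> = N \<sigma> \<tau>) \<Longrightarrow> matop S M c = matop S N c"
  by (simp add: matop_def)

text \<open>The indicator functions of the elements of \<open>S\<close> form a basis, in which the
  diagonal entries are those of \<open>M\<close>. Entries leading out of \<open>S\<close> must
  vanish for the map to preserve the space.\<close>

lemma is_quot_trace_matop:
  assumes "finite S" "\<And>\<sigma> \<tau>. \<sigma> \<in> S \<Longrightarrow> \<tau> \<notin> S \<Longrightarrow> M \<sigma> \<tau> = 0"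
  shows "is_quot_trace (matop S M) {c. \<forall>\<sigma>. \<sigma> \<notin> S \<longrightarrow> c \<sigma> = 0} {\<lambda>_. 0} (\<Sum>\<sigma>\<in>S. of_int (M \<sigma> \<sigma>))"
proof -
  obtain h where h: "bij_betw h {..<card S} S"
    using ex_bij_betw_nat_finite[OF assms(1)] by (auto simp: atLeast0LessThan)
  define vs where "vs i = (\<lambda>\<tau>. if \<tau> = h i then 1 else 0 :: rat)" for i
  have hS: "h i \<in> S" if "i < card S" for i using bij_betw_apply[OF h] that by blast
  have comb_in: "lincomb (card S) a vs (h i) = a i" if "i < card S" for a i
  proof -
    have "(\<Sum>j<card S. a j * vs j (h i)) = (\<Sum>j<card S. if j = i then a j else 0)"
      using h that by (intro sum.cong refl) (auto simp: vs_def bij_betw_def dest: inj_onD)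
    then show ?thesis using that by (simp add: lincomb_def)
  qed
  have comb_out: "lincomb (card S) a vs \<tau> = 0" if "\<tau> \<notin> S" for a \<tau>
    using hS that by (auto simp: lincomb_def vs_def intro!: sum.neutral)
  have comb: "v - lincomb (card S) (\<lambda>i. v (h i)) vs \<in> {\<lambda>_. 0}" if "\<And>\<tau>. \<tau> \<notin> S \<Longrightarrow> v \<tau> = 0" for v
  proof -
    have "(v - lincomb (card S) (\<lambda>i. v (h i)) vs) \<tau> = 0" for \<tau>
    proof (cases "\<tau> \<in> S")
      case True
      then obtain i where "i < card S" "\<tau> = h i" using h by (auto simp: bij_betw_def)
      then show ?thesis by (simp add: comb_in fun_diff_def)
    next
      case False
      then show ?thesis by (simp add: comb_out that fun_diff_def)
    qed
    then have "v - lincomb (card S) (\<lambda>i. v (h i)) vs = (\<lambda>_. 0)" by (rule ext)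
    then show ?thesis by (simp only: singleton_iff)
  qed
  have "quot_basis {c. \<forall>\<sigma>. \<sigma> \<notin> S \<longrightarrow> c \<sigma> = 0} {\<lambda>_. 0} (card S) vs"
    unfolding quot_basis_def
  proof (intro conjI allI impI ballI)
    fix i assume "i < card S"
    then show "vs i \<in> {c. \<forall>\<sigma>. \<sigma> \<notin> S \<longrightarrow> c \<sigma> = 0}" using hS by (auto simp: vs_def)
  next
    fix a j assume "lincomb (card S) a vs \<in> {\<lambda>_. 0}" "j < card S"
    then show "a j = 0" using comb_in[of j a] by simp
  qed (use comb in blast)
  moreover have vsM: "matop S M (vs i) = (\<lambda>\<tau>. of_int (M (h i) \<tau>))" if "i < card S" for i
    using hS[OF that] assms(1)
    by (simp add: matop_def vs_def if_distrib[of "\<lambda>x. x * _"] cong: if_cong)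
  moreover have "matop S M (vs i) - lincomb (card S) (\<lambda>j. of_int (M (h i) (h j))) vs \<in> {\<lambda>_. 0}"
    if "i < card S" for i
    unfolding vsM[OF that] using assms(2) hS[OF that] by (intro comb) simp
  moreover have "(\<Sum>\<sigma>\<in>S. of_int (M \<sigma> \<sigma>)) = (\<Sum>i<card S. of_int (M (h i) (h i)) :: rat)"
    by (rule sum.reindex_bij_betw[OF h, symmetric])
  ultimately show ?thesis unfolding is_quot_trace_def
    by (intro exI[of _ "card S"] exI[of _ vs] exI[of _ "\<lambda>i j. of_int (M (h i) (h j))"]) simp
qed

section \<open>Cycles and boundaries as subspaces of the chains\<close>

lemma lin_subspace_0: "lin_subspace {\<lambda>_. 0}"
  by (simp add: lin_subspace_def)

lemma is_quot_trace_self: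
  assumes "lin_subspace V"
  shows "is_quot_trace \<phi> V V 0"
proof -
  have "quot_basis V V 0 vs" for vs :: "nat \<Rightarrow> 'a \<Rightarrow> rat"
    using assms by (auto simp: quot_basis_def lincomb_def fun_diff_def)
  then show ?thesis unfolding is_quot_trace_def by (intro exI[of _ 0]) simp
qed

lemma lin_subspace_chains: "lin_subspace (chains X n q)"
  by (simp add: lin_subspace_def chains_def)

lemma lin_subspace_cycles: "lin_subspace (cycles X n q)"
  using lin_subspace_chains[of X n q] lin_map_matop[of "cubes X n q" bd_coeff]
    lin_map_zero[OF lin_map_matop[of "cubes X n q" bd_coeff]]
  by (auto simp: lin_subspace_def cycles_def lin_map_def bd_eq_matop)

lemma lin_subspace_boundaries: "lin_subspace (boundaries X n q)"
  unfolding lin_subspace_def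
proof (intro conjI ballI allI)
  show "(\<lambda>_. 0) \<in> boundaries X n q"
    unfolding boundaries_def bd_eq_matop
    by (intro image_eqI[of _ _ "\<lambda>_. 0"] lin_subspace_zero[OF lin_subspace_chains])
      (simp add: lin_map_zero[OF lin_map_matop])
  fix v w a b assume "v \<in> boundaries X n q" "w \<in> boundaries X n q"
  then obtain c d where "c \<in> chains X n (Suc q)" "d \<in> chains X n (Suc q)"
    "v = bd X n (Suc q) c" "w = bd X n (Suc q) d" unfolding boundaries_def by blast
  moreover from this have "(\<lambda>t. a * c t + b * d t) \<in> chains X n (Suc q)"
    by (intro lin_subspace_comb[OF lin_subspace_chains])
  moreover have "bd X n (Suc q) (\<lambda>t. a * c t + b * d t)
      = (\<lambda>t. a * bd X n (Suc q) c t + b * bd X n (Suc q) d t)"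
    using lin_map_matop[of "cubes X n (Suc q)" bd_coeff] unfolding bd_eq_matop lin_map_def by blast
  ultimately show "(\<lambda>t. a * v t + b * w t) \<in> boundaries X n q"
    unfolding boundaries_def by (intro image_eqI[of _ _ "\<lambda>t. a * c t + b * d t"]) simp_all
qed

lemma bd_in_chains: "bd X n (Suc q) c \<in> chains X n q"
proof -
  have "bd X n (Suc q) c \<tau> = 0" if "\<tau> \<notin> cubes X n q" for \<tau>
    unfolding bd_def
    using that bd_coeff_nonzero_face[of _ \<tau>] faces_in_cubes[of _ X n q \<tau>]
    by (intro sum.neutral ballI) auto
  then show ?thesis by (simp add: chains_def)
qed

lemma boundaries_subset_chains: "boundaries X n q \<subseteq> chains X n q"
  using bd_in_chains by (auto simp: boundaries_def)

lemma bd_bd: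
  assumes "finite X"
  shows "bd X n q (bd X n (Suc q) c) = (\<lambda>_. 0)"
proof -
  have "(\<Sum>\<rho>\<in>cubes X n q. bd_coeff \<sigma> \<rho> * bd_coeff \<rho> \<tau>) = 0" if "\<sigma> \<in> cubes X n (Suc q)" for \<sigma> \<tau>
  proof -
    have "(\<Sum>\<rho>\<in>cubes X n q. bd_coeff \<sigma> \<rho> * bd_coeff \<rho> \<tau>) = bdsum \<sigma> (\<lambda>\<rho>. bd_coeff \<rho> \<tau>)"
      using faces_in_cubes[OF that] by (intro sum_bd_coeff_mult finite_cubes[OF assms]) blast
    also have "\<dots> = 0"
      unfolding bd_coeff_eq_bdsum using that by (intro bdsum_bdsum[of n]) (simp add: cubes_def)
    finally show ?thesis .
  qed
  then show ?thesis unfolding bd_eq_matop matop_matop by (simp add: matop_def)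
qed

lemma boundaries_subset_cycles:
  assumes "finite X"
  shows "boundaries X n q \<subseteq> cycles X n q"
  using bd_bd[OF assms] boundaries_subset_chains[of X n q] by (auto simp: cycles_def boundaries_def)

lemma cycles_0: "cycles X n 0 = chains X n 0"
proof -
  have "bd_coeff \<sigma> \<tau> = 0" if "\<sigma> \<in> cubes X n 0" for \<sigma> \<tau>
  proof -
    have "nondeg \<sigma> = {}" using that card_nondeg[of \<sigma>] by (simp add: cubes_def)
    then show ?thesis by (simp add: bd_coeff_eq_bdsum bdsum_def)
  qed
  then have "bd X n 0 c = (\<lambda>_. 0)" for c by (simp add: bd_def)
  then show ?thesis by (simp add: cycles_def)
qed

lemma boundaries_top: "boundaries X n n = {\<lambda>_. 0}"
proof -
  have "cube_dim \<sigma> \<le> n" if "cube_ok n \<sigma>" for \<sigma>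
    unfolding card_nondeg[symmetric] using that card_mono[of "{..<n}" "nondeg \<sigma>"]
    by (auto simp: nondeg_def cube_ok_def)
  then have "cubes X n (Suc n) = {}" by (fastforce simp: cubes_def)
  then have "bd X n (Suc n) c = (\<lambda>_. 0)" for c by (simp add: bd_def)
  moreover have "chains X n (Suc n) \<noteq> {}" using lin_subspace_zero[OF lin_subspace_chains] by blast
  ultimately show ?thesis by (simp add: boundaries_def image_constant_conv)
qed

context digital_map
begin

lemma fbar_in_chains: "fbar X n q f c \<in> chains X n q"
proof -
  have "fbar X n q f c \<tau> = 0" if "\<tau> \<notin> cubes X n q" for \<tau>
    unfolding fbar_def using that fbar_coeff_in_cubes[of _ q \<tau>] by (intro sum.neutral ballI) auto
  then show ?thesis by (simp add: chains_def)
qed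

lemma bd_fbar: "bd X n (Suc q) (fbar X n (Suc q) f c) = fbar X n q f (bd X n (Suc q) c)"
  unfolding bd_eq_matop fbar_eq_matop matop_matop
proof (rule matop_cong)
  fix \<sigma> \<tau> assume \<sigma>: "\<sigma> \<in> cubes X n (Suc q)"
  have "(\<Sum>\<rho>\<in>cubes X n q. bd_coeff \<sigma> \<rho> * fbar_coeff n f \<rho> \<tau>) = bdsum \<sigma> (\<lambda>\<rho>. fbar_coeff n f \<rho> \<tau>)"
    using faces_in_cubes[OF \<sigma>] by (intro sum_bd_coeff_mult finite_cubes[OF finX]) blast
  then show "(\<Sum>\<rho>\<in>cubes X n (Suc q). fbar_coeff n f \<sigma> \<rho> * bd_coeff \<rho> \<tau>)
      = (\<Sum>\<rho>\<in>cubes X n q. bd_coeff \<sigma> \<rho> * fbar_coeff n f \<rho> \<tau>)"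
    using fbar_coeff_chain_map[OF \<sigma>] by simp
qed

lemma fbar_in_cycles:
  assumes "c \<in> cycles X n q"
  shows "fbar X n q f c \<in> cycles X n q"
proof (cases q)
  case 0
  then show ?thesis using fbar_in_chains by (simp add: cycles_0)
next
  case (Suc p)
  then show ?thesis
    using assms bd_fbar[of p c] fbar_in_chains[of q c]
      lin_map_zero[OF lin_map_matop[of "cubes X n p" "fbar_coeff n f"]]
    by (simp add: cycles_def fbar_eq_matop)
qed

lemma fbar_in_boundaries:
  assumes "c \<in> boundaries X n q"
  shows "fbar X n q f c \<in> boundaries X n q"
proof -
  obtain d where "c = bd X n (Suc q) d" using assms unfolding boundaries_def by blast
  then have "fbar X n q f c = bd X n (Suc q) (fbar X n (Suc q) f d)" by (simp add: bd_fbar)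
  then show ?thesis using fbar_in_chains unfolding boundaries_def by blast
qed

text \<open>With b, h and c the traces on boundaries, homology and chains, the filtration gives c(q)
  = b(q) + h(q) + b(q-1). Every c(q) is a sum of diagonal coefficients, hence 0, and the alternating
  sum of the h(q) telescopes.\<close>

lemma lefschetz_eq_0:
  assumes no_fix: "\<And>q \<sigma>. \<sigma> \<in> cubes X n q \<Longrightarrow> fbar_coeff n f \<sigma> \<sigma> = 0"
  shows "lefschetz X n f = 0"
proof -
  have lin: "lin_map (fbar X n q f)" for q unfolding fbar_eq_matop by (rule lin_map_matop)
  have "\<exists>b. is_quot_trace (fbar X n q f) (boundaries X n q) {\<lambda>_. 0} b" for q
  proof (rule is_quot_trace_exists[OF finite_cubes[OF finX, of n q]
        lin_subspace_boundaries lin_subspace_0])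
    show "{\<lambda>_. 0} \<subseteq> boundaries X n q" using lin_subspace_zero[OF lin_subspace_boundaries] by simp
    show "v t = 0" if "v \<in> boundaries X n q" "t \<notin> cubes X n q" for v t
      using that boundaries_subset_chains[of X n q] unfolding chains_def by blast
  qed (rule fbar_in_boundaries)
  then obtain b where b: "\<And>q. is_quot_trace (fbar X n q f) (boundaries X n q) {\<lambda>_. 0} (b q)" by metis
  have h: "is_quot_trace (fbar X n q f) (cycles X n q) (boundaries X n q) (homology_trace X n f q)" for q
  proof -
    have "\<exists>t. is_quot_trace (fbar X n q f) (cycles X n q) (boundaries X n q) t"
    proof (rule is_quot_trace_exists[OF finite_cubes[OF finX, of n q] lin_subspace_cycles
          lin_subspace_boundaries boundaries_subset_cycles[OF finX]])
      show "v t = 0" if "v \<in> cycles X n q" "t \<notin> cubes X n q" for v t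
        using that unfolding cycles_def chains_def by blast
    qed (rule fbar_in_cycles)
    then show ?thesis
      using quot_trace_eqI[OF lin_subspace_boundaries lin fbar_in_boundaries]
      unfolding homology_trace_def by metis
  qed
  \<comment> \<open>The trace on chains modulo cycles: the boundary trace one degree lower, and 0 in
    degree 0, where every chain is a cycle.\<close>
  define b' where "b' q = (case q of 0 \<Rightarrow> 0 | Suc p \<Rightarrow> b p)" for q
  have b': "is_quot_trace (fbar X n q f) (chains X n q) (cycles X n q) (b' q)" for q
  proof (cases q)
    case 0
    then show ?thesis using is_quot_trace_self[OF lin_subspace_chains] by (simp add: b'_def cycles_0)
  next
    case (Suc p)
    have "is_quot_trace (fbar X n (Suc p) f) (chains X n (Suc p))
        {v \<in> chains X n (Suc p). bd X n (Suc p) v = (\<lambda>_. 0)} (b p)"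
      using bd_fbar lin_subspace_chains fbar_in_chains b[of p, unfolded boundaries_def]
      by (rule is_quot_trace_lift[OF lin_map_matop[of "cubes X n (Suc p)" bd_coeff, folded bd_eq_matop]])
    then show ?thesis by (simp add: Suc b'_def cycles_def)
  qed
  have zero: "b q + homology_trace X n f q + b' q = 0" for q
  proof (rule is_quot_trace_unique[OF lin_subspace_0 lin])
    show "is_quot_trace (fbar X n q f) (chains X n q) {\<lambda>_. 0} (b q + homology_trace X n f q + b' q)"
    proof (rule is_quot_trace_add[OF lin_subspace_0 lin_subspace_cycles _ _ _ b'])
      show "is_quot_trace (fbar X n q f) (cycles X n q) {\<lambda>_. 0} (b q + homology_trace X n f q)"
        using lin_subspace_zero[OF lin_subspace_boundaries] boundaries_subset_cycles[OF finX]
        by (intro is_quot_trace_add[OF lin_subspace_0 lin_subspace_boundaries _ _ b h]) simp_all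
      show "{\<lambda>_. 0} \<subseteq> cycles X n q" using lin_subspace_zero[OF lin_subspace_cycles] by simp
      show "cycles X n q \<subseteq> chains X n q" unfolding cycles_def by blast
    qed
    have "is_quot_trace (fbar X n q f) (chains X n q) {\<lambda>_. 0}
        (\<Sum>\<sigma>\<in>cubes X n q. of_int (fbar_coeff n f \<sigma> \<sigma>))"
      unfolding fbar_eq_matop chains_def using fbar_coeff_in_cubes[of _ q]
      by (intro is_quot_trace_matop finite_cubes[OF finX]) blast
    then show "is_quot_trace (fbar X n q f) (chains X n q) {\<lambda>_. 0} 0" using no_fix by simp
  qed (use lin_map_zero[OF lin] in simp)
  \<comment> \<open>Each partial sum leaves only its top boundary trace. At \<open>m = n\<close>
    that trace vanishes too, since there are no cubes of dimension \<open>n + 1\<close>.\<close>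
  have "(\<Sum>q\<le>m. (-1) ^ q * homology_trace X n f q) = - ((-1) ^ m * b m)" for m
  proof (induction m)
    case 0
    then show ?case using zero[of 0] by (simp add: b'_def)
  next
    case (Suc m)
    have h': "homology_trace X n f (Suc m) = - b (Suc m) - b m" using zero[of "Suc m"] by (simp add: b'_def)
    show ?case unfolding sum.atMost_Suc Suc h' by (simp add: algebra_simps)
  qed
  moreover have "b n = 0"
    using is_quot_trace_unique[OF lin_subspace_0 lin _ b[of n, unfolded boundaries_top]
        is_quot_trace_self[OF lin_subspace_0]] lin_map_zero[OF lin] by simp
  ultimately show ?thesis by (simp add: lefschetz_def)
qed

end

theorem theorem4p3:
  fixes X :: "int list set" and n :: nat and f :: "int list \<Rightarrow> int list"
  assumes "n \<le> 4"
    and "finite X"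
    and "\<forall>x\<in>X. length x = n"
    and "digitally_continuous X f"
    and "lefschetz X n f \<noteq> 0"
  shows "\<exists>\<sigma>. cube_ok n \<sigma> \<and> cube_pts \<sigma> \<subseteq> X \<and> f ` cube_pts \<sigma> = cube_pts \<sigma>"
proof (rule ccontr)
  assume no_fix: "\<not> ?thesis"
  interpret digital_map X n f
    using assms(2-4) by unfold_locales simp_all
  \<comment> \<open>A nonzero diagonal coefficient would require \<open>f\<close> to map \<sigma>
    onto itself.\<close>
  have "fbar_coeff n f \<sigma> \<sigma> = 0" if "\<sigma> \<in> cubes X n q" for q \<sigma>
    using no_fix cubeD[OF that] fbar_coeff_nonzero(3)[of n f \<sigma> \<sigma>] by metis
  then have "lefschetz X n f = 0" by (rule lefschetz_eq_0)
  with assms(5) show False by simp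
qed

end
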